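(* Let $(a_k)_{k\in\mathbb N}$ be the sequence defined by $a_0=1$, $a_1=5$ and $a_k=4a_{k-1}-a_{k-2}$. Let $k\in\mathbb N$ and suppose that $q=a_k$ is a prime power. Then the graph $\mathsf G\left(\frac{q^2-1}{2},q^2\right)$ (exists and) is biregular and has spectrum $$\left\{\left[\tfrac{q^4+1}{2}\right]^1,\left[\tfrac{q^2+1}{2}\right]^{\frac{q^4-2q^2-1}{2}},\left[\tfrac{1-q^2}{2}\right]^{\frac{q^4+2q^2-1}{2}}\right\}.$$
   Context: All graphs are finite, undirected and simple; the spectrum of a graph is the multiset of eigenvalues of its adjacency matrix, and $[\theta]^{m}$ means that $\theta$ has multiplicity $m$. A graph is biregular if its vertices have exactly two distinct degrees. $J$ is an all-ones matrix. For $m\geqslant2$, $n\geqslant1$, an orthogonal array $\operatorname{OA}(m,n)$ is an $m\times n^2$ matrix with entries in $\{1,\dots,n\}$ such that the $n^2$ columns of each $2\times n^2$ submatrix contain all $n^2$ ordered pairs of elements of $\{1,\dots,n\}$. It is known that an $\operatorname{OA}(m,n)$ exists whenever $n$ is a prime power and $2\leqslant m\leqslant n+1$. The block graph $\mathsf{OA}(m,n)$ has as vertices the columns of $\operatorname{OA}(m,n)$, two columns being adjacent when they share the same entry in some row. For $i\in\{1,\dots,n\}$ let $C_i$ be the set of columns having entry $i$ in the first row; these are pairwise disjoint cliques of order $n$. Switching: for a graph $\Gamma=(V,E)$ and a partition $\sigma=\{U,V\setminus U\}$ of $V$, with $A(\Gamma)=\begin{bmatrix}A(\Gamma[U])&M\\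 M^\top&A(\Gamma[V\setminus U])\end{bmatrix}$, the switched graph $\Gamma^\sigma$ has adjacency matrix $\begin{bmatrix}A(\Gamma[U])&J-M\\ J-M^\top&A(\Gamma[V\setminus U])\end{bmatrix}$. Let $\mathsf S_N(m,n)$ be the graph obtained by switching $\Gamma=\mathsf{OA}(m,n)$ with respect to $\{U,V\setminus U\}$ where $U=C_1\cup\dots\cup C_N$. If an $\operatorname{OA}(m,n)$ exists and $$N=\frac n2-\frac{\sqrt{(n-2m)(n-2m+2)(n+2)n}}{2(n-2m+2)}$$ is a positive integer less than $n$, define $\mathsf G(m,n):=\mathsf S_N(m,n)$ for this $N$ (formed from an orthogonal array $\operatorname{OA}(m,n)$, the choice of which is suppressed in the notation). *)

theory Defs
  imports
    "HOL-Number_Theory.Prime_Powers"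
    "Graph_Theory.Pair_Digraph"
    "Jordan_Normal_Form.Char_Poly"
begin

text \<open>
  A finite simple undirected graph is a \<^verbatim>\<open>pair_graph\<close>: a finite, loop-free, symmetric digraph
  without parallel arcs.
\<close>

definition adjacency_matrix :: "'a :: linorder pair_pre_digraph \<Rightarrow> real mat" where
  "adjacency_matrix G =
     (let vs = sorted_list_of_set (pverts G) in
      mat (length vs) (length vs) (\<lambda>(i, j). if (vs ! i, vs ! j) \<in> parcs G then 1 else 0))"

text \<open>
  The eigenvalues, each repeated according to its multiplicity as a root of the characteristic
  polynomial. Adjacency matrices of undirected graphs are real symmetric, so no eigenvalue is lost
  by working over the reals, and algebraic and geometric multiplicities agree.
\<close>

definition graph_spectrum :: "'a :: linorder pair_pre_digraph \<Rightarrow> real multiset" where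
  "graph_spectrum G = proots (char_poly (adjacency_matrix G))"

text \<open>In a symmetric digraph the out-degree is the degree of the undirected graph.\<close>

definition biregular :: "'a pair_pre_digraph \<Rightarrow> bool" where
  "biregular G \<longleftrightarrow> card (out_degree (with_proj G) ` pverts G) = 2"

text \<open>Rows and columns are numbered from \<open>0\<close>, the symbols are \<open>1, \<dots>, n\<close>.\<close>

definition orthogonal_array :: "nat \<Rightarrow> nat \<Rightarrow> nat mat \<Rightarrow> bool" where
  "orthogonal_array m n A \<longleftrightarrow>
     2 \<le> m \<and> 1 \<le> n \<and> A \<in> carrier_mat m (n ^ 2) \<and>
     (\<forall>r < m. \<forall>c < n ^ 2. A $$ (r, c) \<in> {1..n}) \<and>
     (\<forall>r < m. \<forall>s < m. r \<noteq> s \<longrightarrow>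
        (\<forall>x \<in> {1..n}. \<forall>y \<in> {1..n}. \<exists>c < n ^ 2. A $$ (r, c) = x \<and> A $$ (s, c) = y))"

text \<open>
  A column is represented by its index. This is harmless since the columns of an
  orthogonal array are pairwise distinct (lemma \<open>orthogonal_array_inj_on_col\<close> below).
\<close>

definition block_graph :: "nat mat \<Rightarrow> nat pair_pre_digraph" where
  "block_graph A = \<lparr>
     pverts = {..<dim_col A},
     parcs = {(c, d). c < dim_col A \<and> d < dim_col A \<and> c \<noteq> d \<and>
                (\<exists>r < dim_row A. A $$ (r, c) = A $$ (r, d))} \<rparr>"

definition row_clique :: "nat mat \<Rightarrow> nat \<Rightarrow> nat set" where
  "row_clique A i = {c. c < dim_col A \<and> A $$ (0, c) = i}"

text \<open>Adjacency is kept inside each of the two parts and complemented between them.\<close>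

definition switching :: "'a pair_pre_digraph \<Rightarrow> 'a set \<Rightarrow> 'a pair_pre_digraph" where
  "switching G U = \<lparr>
     pverts = pverts G,
     parcs = {(u, v). u \<in> pverts G \<and> v \<in> pverts G \<and>
                (if u \<in> U \<longleftrightarrow> v \<in> U then (u, v) \<in> parcs G else (u, v) \<notin> parcs G)} \<rparr>"

definition S_graph :: "nat \<Rightarrow> nat mat \<Rightarrow> nat pair_pre_digraph" where
  "S_graph N A = switching (block_graph A) (\<Union>i \<in> {1..N}. row_clique A i)"

text \<open>
  All graphs \<open>G(m, n)\<close>, over all choices of the orthogonal array. The set is empty when no
  orthogonal array exists or when the formula does not yield a positive integer \<open>N < n\<close>.
  The conditions on \<open>n - 2 * m + 2\<close> and on the radicand say that the formula for \<open>N\<close> is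
  meaningful; without them the totalised division and square root could give spurious values.
\<close>

definition G_graphs :: "nat \<Rightarrow> nat \<Rightarrow> nat pair_pre_digraph set" where
  "G_graphs m n = {S_graph N A | N A.
     orthogonal_array m n A \<and> 0 < N \<and> N < n \<and>
     (let m' = real m; n' = real n;
          d = n' - 2 * m' + 2; R = (n' - 2 * m') * d * (n' + 2) * n'
      in d \<noteq> 0 \<and> 0 \<le> R \<and> real N = n' / 2 - sqrt R / (2 * d))}"

lemma pair_graph_block_graph: "pair_graph (block_graph A)"
proof -
  have "parcs (block_graph A) \<subseteq> {..<dim_col A} \<times> {..<dim_col A}"
    by (auto simp: block_graph_def)
  then have "finite (parcs (block_graph A))"
    by (rule finite_subset) simp
  moreover have "sym (parcs (block_graph A))"
    by (fastforce simp: block_graph_def sym_def)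
  ultimately show ?thesis
    by unfold_locales
       (auto simp: block_graph_def symmetric_def with_proj_def arcs_ends_def arc_to_ends_def
             split: prod.splits)
qed

lemma pair_graph_switching:
  assumes "pair_graph G"
  shows "pair_graph (switching G U)"
proof -
  interpret pair_graph G by fact
  have "parcs (switching G U) \<subseteq> pverts G \<times> pverts G"
    by (auto simp: switching_def)
  then have fin: "finite (parcs (switching G U))"
    by (rule finite_subset) (simp add: pair_finite_verts)
  have "sym (parcs G)"
    using pair_sym_arcs by (simp add: symmetric_def)
  then have "sym (parcs (switching G U))"
    by (auto simp: switching_def sym_def)
  moreover have "fst e \<noteq> snd e" if "e \<in> parcs (switching G U)" for e
    using that pair_no_loops[of e] by (auto simp: switching_def split: if_splits)
  ultimately show ?thesis
    using fin pair_finite_verts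
    by unfold_locales (auto simp: symmetric_def switching_def)
qed

lemma pair_graph_S_graph: "pair_graph (S_graph N A)"
  unfolding S_graph_def by (intro pair_graph_switching pair_graph_block_graph)

lemma orthogonal_array_inj_on_col:
  assumes "orthogonal_array m n A"
  shows "inj_on (col A) {..<n ^ 2}"
proof -
  have m: "2 \<le> m" and A: "A \<in> carrier_mat m (n ^ 2)"
    and entries: "\<And>r c. r < m \<Longrightarrow> c < n ^ 2 \<Longrightarrow> A $$ (r, c) \<in> {1..n}"
    and pairs: "\<And>x y. x \<in> {1..n} \<Longrightarrow> y \<in> {1..n} \<Longrightarrow>
      \<exists>c < n ^ 2. A $$ (0, c) = x \<and> A $$ (1, c) = y"
    using assms unfolding orthogonal_array_def by auto
  let ?f = "\<lambda>c. (A $$ (0, c), A $$ (1, c))"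
  have "?f ` {..<n ^ 2} = {1..n} \<times> {1..n}"
  proof (intro subset_antisym subsetI)
    fix z assume "z \<in> ?f ` {..<n ^ 2}"
    then obtain c where "c < n ^ 2" "z = ?f c" by auto
    then show "z \<in> {1..n} \<times> {1..n}"
      using entries[of 0 c] entries[of 1 c] m by simp
  next
    fix z assume "z \<in> {1..n} \<times> {1..n}"
    then obtain x y where z: "z = (x, y)" "x \<in> {1..n}" "y \<in> {1..n}" by blast
    then obtain c where "c < n ^ 2" "A $$ (0, c) = x" "A $$ (1, c) = y"
      using pairs by blast
    then show "z \<in> ?f ` {..<n ^ 2}" using z by (auto intro!: image_eqI[of _ _ c])
  qed
  then have "card (?f ` {..<n ^ 2}) = card {..<n ^ 2}"
    by (simp add: power2_eq_square)
  then have inj: "inj_on ?f {..<n ^ 2}"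
    by (intro eq_card_imp_inj_on) auto
  show ?thesis
  proof (rule inj_onI)
    fix c d assume cd: "c \<in> {..<n ^ 2}" "d \<in> {..<n ^ 2}" and eq: "col A c = col A d"
    have *: "col A e $ r = A $$ (r, e)" if "r < m" "e \<in> {..<n ^ 2}" for r e
      using that A by auto
    have "?f c = ?f d"
      using *[of 0 c] *[of 0 d] *[of 1 c] *[of 1 d] cd eq m by simp
    with inj cd show "c = d" by (auto dest: inj_onD)
  qed
qed

end

theory Submission
  imports Defs "Jordan_Normal_Form.Schur_Decomposition"
begin

text \<open>
  Put \<open>n = q\<^sup>2\<close> and \<open>m = (n - 1)/2\<close>, so that \<open>n - 2 m = 1\<close>.

  Existence. The recurrence gives \<open>q\<^sup>2 + 2 = 3 b\<^sup>2\<close> with \<open>q\<close>, \<open>b\<close> odd and \<open>b < q\<close>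
  (\<open>recurrence_odd_and_norm_equation\<close>), which turns the formula for the number of switched cliques into the
  integer \<open>N = q (q - b)/2\<close>. An orthogonal array with \<open>m \<le> n\<close> rows over \<open>n\<close> symbols is obtained from
  the affine plane over a field of order \<open>n\<close> (\<open>orthogonal_array_exists\<close>); the field is found
  inside a quotient of a ring of cyclotomic integers (\<open>finite_field_representatives\<close>).

  Spectrum. Let \<open>d\<close> be the vector of signs that is \<open>1\<close> on the switched cliques and \<open>- 1\<close> elsewhere,
  \<open>D\<close> the diagonal matrix with diagonal \<open>d\<close>, and \<open>E = 2 N - n\<close>. The switched adjacency matrix is
  \<open>B = J/2 + D (A - J/2) D\<close>. The matrix \<open>A + m I\<close> is a sum of \<open>m\<close> block matrices, one for each row
  of the array, any two of which have product \<open>J\<close>, so \<open>B\<^sup>2\<close> can be computed explicitly. The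
  condition \<open>3 E\<^sup>2 = n (n + 2)\<close>, which is the formula for \<open>N\<close>, is exactly what makes
  \<open>(B - y)(B - z) = 3/4 w w\<^sup>T\<close> a matrix of rank one, where \<open>y = (n + 1)/2\<close>, \<open>z = (1 - n)/2\<close> and
  \<open>w = d - E 1\<close>. Moreover \<open>B w = x w\<close> for \<open>x = (n\<^sup>2 + 1)/2\<close>. Hence \<open>x\<close>, \<open>y\<close>, \<open>z\<close> are the only
  possible eigenvalues, and the traces of \<open>B\<close> and \<open>B\<^sup>2\<close> determine the multiplicities
  (\<open>proots_char_poly_rank_one_quadratic\<close>). The row sums of \<open>B\<close> take two distinct values, one on each
  side of the switching, because \<open>E \<noteq> 0\<close>.
\<close>

section \<open>Prime ideals and roots of unity\<close>

text \<open>
  An ideal of a commutative ring, as a bare subset of the type. Negation is multiplication by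
  \<open>- 1\<close>. The whole ring is allowed; properness is stated separately as \<open>1 \<notin> I\<close>.
\<close>

definition ring_ideal :: "'a :: comm_ring_1 set \<Rightarrow> bool" where
  "ring_ideal I \<longleftrightarrow> 0 \<in> I \<and> (\<forall>x \<in> I. \<forall>y \<in> I. x + y \<in> I) \<and> (\<forall>r. \<forall>x \<in> I. r * x \<in> I)"

lemma ring_ideal_add: "ring_ideal I \<Longrightarrow> x \<in> I \<Longrightarrow> y \<in> I \<Longrightarrow> x + y \<in> I"
  and ring_ideal_mult: "ring_ideal I \<Longrightarrow> x \<in> I \<Longrightarrow> r * x \<in> I"
  by (auto simp: ring_ideal_def)

lemma ring_ideal_mult_right: "ring_ideal I \<Longrightarrow> x \<in> I \<Longrightarrow> x * r \<in> I"
  using ring_ideal_mult[of I x r] by (simp add: mult.commute)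

lemma ring_ideal_diff: "ring_ideal I \<Longrightarrow> x \<in> I \<Longrightarrow> y \<in> I \<Longrightarrow> x - y \<in> I"
  using ring_ideal_add[of I x "- y"] ring_ideal_mult[of I y "- 1"] by simp

lemma ring_ideal_Union_chain:
  assumes "C \<noteq> {}" "\<And>I. I \<in> C \<Longrightarrow> ring_ideal I" "subset.chain UNIV C"
  shows "ring_ideal (\<Union>C)"
  unfolding ring_ideal_def
proof (intro conjI ballI allI)
  show "0 \<in> \<Union>C" using assms(1,2) by (auto simp: ring_ideal_def)
next
  fix x y assume "x \<in> \<Union>C" "y \<in> \<Union>C"
  then obtain I J where IJ: "I \<in> C" "J \<in> C" "x \<in> I" "y \<in> J" by blast
  then have "I \<subseteq> J \<or> J \<subseteq> I" using assms(3) by (auto simp: subset.chain_def)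
  then obtain K where "K \<in> C" "x \<in> K" "y \<in> K" using IJ by blast
  then show "x + y \<in> \<Union>C" using assms(2) ring_ideal_add by blast
next
  fix r x assume "x \<in> \<Union>C"
  then show "r * x \<in> \<Union>C" using assms(2) ring_ideal_mult by blast
qed

text \<open>
  Zorn's lemma yields an ideal that is maximal among the proper ones above \<open>I\<close>; outside of it
  every element is invertible modulo the ideal, so it is prime.
\<close>

lemma exists_prime_ideal:
  fixes I :: "'a :: comm_ring_1 set"
  assumes I: "ring_ideal I" "1 \<notin> I"
  obtains M where "ring_ideal M" "I \<subseteq> M" "1 \<notin> M" "\<And>x y. x * y \<in> M \<Longrightarrow> x \<in> M \<or> y \<in> M"
proof -
  let ?A = "{J. ring_ideal J \<and> I \<subseteq> J \<and> 1 \<notin> J}"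
  have "\<exists>M\<in>?A. \<forall>X\<in>?A. M \<subseteq> X \<longrightarrow> X = M"
  proof (rule subset_Zorn_nonempty)
    show "?A \<noteq> {}" using I by blast
    fix C assume C: "C \<noteq> {}" "subset.chain ?A C"
    then have sub: "C \<subseteq> ?A" by (auto simp: subset.chain_def)
    have "subset.chain UNIV C" using C(2) by (auto simp: subset.chain_def)
    then have "ring_ideal (\<Union>C)" using ring_ideal_Union_chain[OF C(1)] sub by blast
    moreover have "I \<subseteq> \<Union>C" using sub C(1) by blast
    ultimately show "\<Union>C \<in> ?A" using sub by blast
  qed
  then obtain M where M: "ring_ideal M" "I \<subseteq> M" "1 \<notin> M"
    and max: "\<forall>X\<in>?A. M \<subseteq> X \<longrightarrow> X = M" by auto
  have inverse: "\<exists>r. 1 - r * x \<in> M" if x: "x \<notin> M" for x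
  proof -
    let ?X = "{z. \<exists>r. z - r * x \<in> M}"
    have "ring_ideal ?X"
      unfolding ring_ideal_def
    proof (intro conjI ballI allI)
      show "0 \<in> ?X" using M(1) by (auto simp: ring_ideal_def intro!: exI[of _ 0])
    next
      fix u v assume "u \<in> ?X" "v \<in> ?X"
      then obtain r s where "u - r * x \<in> M" "v - s * x \<in> M" by blast
      then have "(u - r * x) + (v - s * x) \<in> M" using M(1) ring_ideal_add by blast
      then show "u + v \<in> ?X" by (auto simp: algebra_simps intro!: exI[of _ "r + s"])
    next
      fix t u assume "u \<in> ?X"
      then obtain r where "u - r * x \<in> M" by blast
      then have "t * (u - r * x) \<in> M" using M(1) ring_ideal_mult by blast
      then show "t * u \<in> ?X" by (auto simp: algebra_simps intro!: exI[of _ "t * r"])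
    qed
    moreover have "M \<subseteq> ?X" by (auto intro!: exI[of _ 0])
    moreover have "x \<in> ?X" using M(1) by (auto simp: ring_ideal_def intro!: exI[of _ 1])
    ultimately have "\<not> 1 \<notin> ?X" using max x M(2) by blast
    then show ?thesis by simp
  qed
  have "x \<in> M \<or> y \<in> M" if xy: "x * y \<in> M" for x y
  proof (rule ccontr)
    assume "\<not> (x \<in> M \<or> y \<in> M)"
    then obtain r where r: "1 - r * x \<in> M" and y: "y \<notin> M" using inverse by blast
    then have "y * (1 - r * x) + r * (x * y) \<in> M"
      using ring_ideal_add[OF M(1) ring_ideal_mult[OF M(1) r] ring_ideal_mult[OF M(1) xy]] by blast
    moreover have "y * (1 - r * x) + r * (x * y) = y" by (simp add: algebra_simps)
    ultimately show False using y by simp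
  qed
  with M that show thesis by blast
qed

text \<open>
  Multiplication by \<open>f(z)\<close> acts on the vector \<open>(1, z, \<dots>, z\<^sup>N\<^sup>-\<^sup>1)\<close> as an integer circulant
  matrix, so \<open>f(z)\<close> is a root of a monic integer characteristic polynomial.
\<close>

lemma algebraic_int_poly_root_of_unity:
  fixes z :: complex and f :: "int poly"
  assumes z: "z ^ N = 1" and N: "N > 0"
  shows "algebraic_int (poly (of_int_poly f) z)"
proof -
  define B :: "int mat" where
    "B = mat N N (\<lambda>(i, j). \<Sum>k | k \<le> degree f \<and> (i + k) mod N = j. coeff f k)"
  define v where "v = vec N (\<lambda>i. z ^ i)"
  let ?w = "poly (of_int_poly f) z"
  let ?B = "map_mat complex_of_int B"
  have B: "B \<in> carrier_mat N N" "?B \<in> carrier_mat N N" by (simp_all add: B_def)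
  have zmod: "z ^ (i mod N) = z ^ i" for i
  proof -
    have "z ^ i = z ^ (N * (i div N) + i mod N)" unfolding mult_div_mod_eq ..
    also have "\<dots> = z ^ (i mod N)" unfolding power_add power_mult z by simp
    finally show ?thesis by simp
  qed
  have w: "?w = (\<Sum>k\<le>degree f. of_int (coeff f k) * z ^ k)"
    by (simp add: poly_altdef)
  have "?B *\<^sub>v v = ?w \<cdot>\<^sub>v v"
  proof (rule eq_vecI)
    fix i assume "i < dim_vec (?w \<cdot>\<^sub>v v)"
    then have i: "i < N" by (simp add: v_def)
    have "(?B *\<^sub>v v) $ i = (\<Sum>j<N. of_int (B $$ (i, j)) * z ^ j)"
      using i by (simp add: B_def v_def scalar_prod_def atLeast0LessThan)
    also have "\<dots> = (\<Sum>j<N. \<Sum>k | k \<in> {..degree f} \<and> (i + k) mod N = j. of_int (coeff f k) * z ^ ((i + k) mod N))"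
      using i by (intro sum.cong refl) (simp add: B_def sum_distrib_right)
    also have "\<dots> = (\<Sum>k\<le>degree f. of_int (coeff f k) * z ^ ((i + k) mod N))"
      using N by (intro sum.group) auto
    also have "\<dots> = ?w * z ^ i"
      by (simp add: w zmod power_add sum_distrib_left sum_distrib_right mult_ac)
    finally show "(?B *\<^sub>v v) $ i = (?w \<cdot>\<^sub>v v) $ i" using i by (simp add: v_def)
  qed (simp_all add: B_def v_def)
  moreover have "v \<noteq> 0\<^sub>v N"
  proof
    assume "v = 0\<^sub>v N"
    then have "v $ 0 = 0" using N by simp
    then show False using N by (simp add: v_def)
  qed
  ultimately have "eigenvalue ?B ?w"
    using B by (auto simp: eigenvalue_def eigenvector_def v_def intro!: exI[of _ v])
  then have "poly (char_poly ?B) ?w = 0"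
    using eigenvalue_root_char_poly[OF B(2)] by simp
  then have "poly (of_int_poly (char_poly B)) ?w = 0"
    using of_int_hom.char_poly_hom[OF B(1), where 'a = complex] by simp
  moreover have "lead_coeff (char_poly B) = 1"
    using degree_monic_char_poly[OF B(1)] by simp
  ultimately show ?thesis unfolding algebraic_int_altdef_ipoly by blast
qed

lemma prod_minus_roots_of_unity:
  fixes z w :: complex
  assumes N: "N > 0" and z: "z = cis (2 * pi / N)"
  shows "(\<Prod>i<N. w - z ^ i) = w ^ N - 1"
proof -
  define p :: "complex poly" where "p = monom 1 N - 1"
  have pz: "poly p u = u ^ N - 1" for u by (simp add: p_def poly_monom)
  have deg: "degree p = N"
    using N unfolding p_def using degree_add_eq_left[of "- 1" "monom (1 :: complex) N"] by (simp add: degree_monom_eq)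
  have lc: "lead_coeff p = 1" unfolding deg using N by (simp add: p_def)
  have "rsquarefree p"
    unfolding rsquarefree_roots
  proof (intro allI notI)
    fix u assume u: "poly p u = 0 \<and> poly (pderiv p) u = 0"
    have "pderiv p = monom (of_nat N) (N - 1)"
      by (simp add: p_def pderiv_diff pderiv_monom)
    then have "of_nat N * u ^ (N - 1) = 0" using u by (simp only: poly_monom)
    moreover have "u ^ N = 1" using u pz by simp
    ultimately have "u ^ (N - 1) = 0" using N by (metis mult_eq_0_iff of_nat_eq_0_iff not_gr0)
    then have "u = 0" by simp
    with \<open>u ^ N = 1\<close> N show False by (simp add: power_0_left)
  qed
  then have "(\<Prod>u | poly p u = 0. [:- u, 1:]) = p"
    using complex_poly_decompose_rsquarefree[of p] lc by simp
  then have "poly p w = poly (\<Prod>u | poly p u = 0. [:- u, 1:]) w" by simp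
  also have "\<dots> = (\<Prod>u | u ^ N = 1. w - u)" by (simp add: poly_prod pz)
  also have "\<dots> = (\<Prod>i<N. w - z ^ i)"
  proof (rule prod.reindex_bij_betw[symmetric])
    have "z ^ i = cis (2 * pi * real i / real N)" for i
      by (simp add: z DeMoivre mult_ac)
    then show "bij_betw (\<lambda>i. z ^ i) {..<N} {u. u ^ N = 1}"
      using bij_betw_roots_unity[OF N] by simp
  qed
  finally show ?thesis by (simp add: pz)
qed

section \<open>Finite fields and orthogonal arrays\<close>

lemma ring_ideal_cong_trans:
  "ring_ideal M \<Longrightarrow> x - y \<in> M \<Longrightarrow> y - z \<in> M \<Longrightarrow> x - z \<in> M"
  using ring_ideal_add[of M "x - y" "y - z"] by simp

lemma ring_ideal_cong_sym: "ring_ideal M \<Longrightarrow> x - y \<in> M \<Longrightarrow> y - x \<in> M"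
  using ring_ideal_mult[of M "x - y" "- 1"] by simp

lemma ring_ideal_cong_add:
  assumes "ring_ideal M" "x - x' \<in> M" "y - y' \<in> M"
  shows "(x + y) - (x' + y') \<in> M"
  using ring_ideal_add[OF assms] by (simp add: algebra_simps)

lemma ring_ideal_cong_mult:
  assumes "ring_ideal M" "x - x' \<in> M" "y - y' \<in> M"
  shows "x * y - x' * y' \<in> M"
proof -
  have "y * (x - x') + x' * (y - y') \<in> M"
    using assms by (intro ring_ideal_add ring_ideal_mult)
  then show ?thesis by (simp add: algebra_simps)
qed

lemma ring_ideal_cong_power:
  assumes "ring_ideal M" "x - y \<in> M"
  shows "x ^ k - y ^ k \<in> M"
proof (induction k)
  case 0
  then show ?case using assms(1) by (simp add: ring_ideal_def)
next
  case (Suc k)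
  then show ?case using ring_ideal_cong_mult[OF assms Suc] by simp
qed

lemma ring_ideal_sum: "ring_ideal M \<Longrightarrow> (\<And>i. i \<in> A \<Longrightarrow> f i \<in> M) \<Longrightarrow> sum f A \<in> M"
  by (induction A rule: infinite_finite_induct) (auto simp: ring_ideal_def)

lemma frobenius_mod_ideal:
  fixes x y :: "'a :: comm_ring_1"
  assumes M: "ring_ideal M" "of_nat p \<in> M" and p: "prime p"
  shows "(x + y) ^ (p ^ e) - (x ^ (p ^ e) + y ^ (p ^ e)) \<in> M"
proof (induction e)
  case 0
  then show ?case using M(1) by (simp add: ring_ideal_def)
next
  case (Suc e)
  have frob: "(a + b) ^ p - (a ^ p + b ^ p) \<in> M" for a b :: 'a
  proof -
    have p0: "p > 0" using p prime_gt_0_nat by blast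
    have "(a + b) ^ p = (\<Sum>k\<le>p. of_nat (p choose k) * a ^ k * b ^ (p - k))"
      by (rule binomial_ring)
    also have "\<dots> = (\<Sum>k\<in>{0, p}. of_nat (p choose k) * a ^ k * b ^ (p - k))
        + (\<Sum>k\<in>{1..<p}. of_nat (p choose k) * a ^ k * b ^ (p - k))"
    proof -
      have "{..p} = {0, p} \<union> {1..<p}" using p0 by auto
      show ?thesis unfolding \<open>{..p} = {0, p} \<union> {1..<p}\<close> by (rule sum.union_disjoint) auto
    qed
    finally have "(a + b) ^ p - (a ^ p + b ^ p)
        = (\<Sum>k\<in>{1..<p}. of_nat (p choose k) * a ^ k * b ^ (p - k))"
      using p0 by simp
    also have "\<dots> \<in> M"
    proof (rule ring_ideal_sum[OF M(1)])
      fix k assume "k \<in> {1..<p}"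
      then have "p dvd (p choose k)" by (intro dvd_choose_prime p) auto
      then obtain c where "p choose k = c * p" by (metis dvd_def mult.commute)
      then have "of_nat (p choose k) * a ^ k * b ^ (p - k) = (of_nat c * a ^ k * b ^ (p - k)) * of_nat p"
        by (simp add: mult_ac)
      then show "of_nat (p choose k) * a ^ k * b ^ (p - k) \<in> M"
        using ring_ideal_mult[OF M] by simp
    qed
    finally show ?thesis .
  qed
  have "((x + y) ^ (p ^ e)) ^ p - (x ^ (p ^ e) + y ^ (p ^ e)) ^ p \<in> M"
    by (rule ring_ideal_cong_power[OF M(1) Suc])
  from ring_ideal_cong_trans[OF M(1) this frob]
  show ?case by (simp add: power_mult[symmetric] mult.commute)
qed

text \<open>
  A finite field with \<open>n = p\<^sup>e\<close> elements, given as a system \<open>R\<close> of representatives modulo a prime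
  ideal \<open>M\<close> of \<open>\<int>[X]\<close>, with \<open>R\<close> closed under addition and multiplication modulo \<open>M\<close>. Let \<open>\<zeta>\<close> be a
  primitive root of unity of order \<open>N = n - 1\<close>. Since \<open>1/p\<close> is not an algebraic integer, \<open>p\<close> is
  not a unit of \<open>\<int>[\<zeta>]\<close>, and \<open>M\<close> is the pull-back of a prime ideal of \<open>\<int>[\<zeta>]\<close> above \<open>p\<close>. As
  \<open>N \<equiv> - 1\<close> modulo \<open>p\<close>, the powers of \<open>\<zeta>\<close> stay distinct modulo this ideal, and together with
  \<open>0\<close> they are the \<open>n\<close> representatives. They are closed under the operations because they
  represent precisely the solutions of \<open>z\<^sup>n = z\<close> modulo \<open>M\<close>, a subring by Frobenius.
\<close>

lemma finite_field_representatives: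
  assumes "primepow n"
  obtains M R :: "int poly set"
  where "ring_ideal M" "\<And>x y. x * y \<in> M \<Longrightarrow> x \<in> M \<or> y \<in> M"
    and "finite R" "card R = n"
    and "\<And>x y. x \<in> R \<Longrightarrow> y \<in> R \<Longrightarrow> x - y \<in> M \<Longrightarrow> x = y"
    and "\<And>x y. x \<in> R \<Longrightarrow> y \<in> R \<Longrightarrow> \<exists>z\<in>R. x + y - z \<in> M"
    and "\<And>x y. x \<in> R \<Longrightarrow> y \<in> R \<Longrightarrow> \<exists>z\<in>R. x * y - z \<in> M"
proof -
  obtain p e where p: "prime p" and e: "e > 0" and n: "n = p ^ e"
    using assms by (auto simp: primepow_def)
  have p1: "p > 1" using p prime_gt_1_nat by blast
  have n1: "n > 1" using primepow_gt_Suc_0[OF assms] by simp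
  define N where "N = n - 1"
  have N: "N > 0" "n = Suc N" using n1 by (auto simp: N_def)
  define \<zeta> where "\<zeta> = cis (2 * pi / N)"
  have zeta_power: "\<zeta> ^ i = cis (2 * pi * real i / real N)" for i
    by (simp add: \<zeta>_def DeMoivre mult_ac)
  have zeta_inj: "inj_on (\<lambda>i. \<zeta> ^ i) {..<N}"
    using bij_betw_roots_unity[OF N(1)] by (simp add: zeta_power bij_betw_def)
  have zeta_N: "\<zeta> ^ N = 1" using N by (simp add: zeta_power)
  define \<phi> where "\<phi> f = poly (of_int_poly f) \<zeta>" for f :: "int poly"
  have \<phi>_hom: "\<phi> 0 = 0" "\<phi> 1 = 1" "\<phi> (f + g) = \<phi> f + \<phi> g" "\<phi> (f * g) = \<phi> f * \<phi> g"
    "\<phi> (f - g) = \<phi> f - \<phi> g" "\<phi> (f ^ k) = \<phi> f ^ k" "\<phi> (of_nat k) = of_nat k" for f g k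
    by (simp_all add: \<phi>_def hom_distribs)
  define X :: "int poly" where "X = [:0, 1:]"
  have \<phi>_X: "\<phi> X = \<zeta>" by (simp add: \<phi>_def X_def)
  \<comment> \<open>The pull-back of \<open>p\<int>[\<zeta>]\<close> to \<open>\<int>[X]\<close>; it contains \<open>p\<close> and the kernel of evaluation at \<open>\<zeta>\<close>.\<close>
  define I where "I = {f. \<exists>g. \<phi> f = of_nat p * \<phi> g}"
  have "ring_ideal I"
    unfolding ring_ideal_def
  proof (intro conjI ballI allI)
    show "0 \<in> I" unfolding I_def using \<phi>_hom(1) by (auto intro!: exI[of _ 0])
    show "f + g \<in> I" if "f \<in> I" "g \<in> I" for f g
    proof -
      from that obtain f' g' where "\<phi> f = of_nat p * \<phi> f'" "\<phi> g = of_nat p * \<phi> g'"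
        by (auto simp: I_def)
      then have "\<phi> (f + g) = of_nat p * \<phi> (f' + g')" by (simp add: \<phi>_hom ring_distribs)
      then show ?thesis unfolding I_def by blast
    qed
    show "r * f \<in> I" if "f \<in> I" for r f
    proof -
      from that obtain f' where "\<phi> f = of_nat p * \<phi> f'" by (auto simp: I_def)
      then have "\<phi> (r * f) = of_nat p * \<phi> (r * f')" by (simp add: \<phi>_hom)
      then show ?thesis unfolding I_def by blast
    qed
  qed
  moreover have "1 \<notin> I"
  proof
    assume "1 \<in> I"
    then obtain g where g: "1 = of_nat p * \<phi> g" by (auto simp: I_def \<phi>_hom)
    have "algebraic_int (\<phi> g)"
      unfolding \<phi>_def by (rule algebraic_int_poly_root_of_unity[OF zeta_N N(1)])
    moreover have eq: "\<phi> g = inverse (of_nat p)" using g by (metis inverse_unique)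
    moreover have "inverse (of_nat p) \<in> (\<rat> :: complex set)" by simp
    ultimately have "\<phi> g \<in> \<int>" using rational_algebraic_int_is_int by metis
    then obtain k where "\<phi> g = of_int k" by (auto elim: Ints_cases)
    then have "(of_int 1 :: complex) = of_int (int p * k)" using g by simp
    then have "1 = int p * k" unfolding of_int_eq_iff .
    then have "int p dvd 1" by (metis dvd_triv_left)
    then show False using p1 by simp
  qed
  ultimately obtain M where M: "ring_ideal M" "I \<subseteq> M" "1 \<notin> M"
    and M_prime: "\<And>x y. x * y \<in> M \<Longrightarrow> x \<in> M \<or> y \<in> M"
    using exists_prime_ideal by metis
  have kernel: "f \<in> M" if "\<phi> f = 0" for f
  proof -
    have "\<phi> f = of_nat p * \<phi> 0" using that by (simp add: \<phi>_hom)
    then have "f \<in> I" unfolding I_def by blast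
    then show ?thesis using M(2) by blast
  qed
  have p_in: "of_nat p \<in> M"
  proof -
    have "\<phi> (of_nat p) = of_nat p * \<phi> 1" by (simp add: \<phi>_hom)
    then have "of_nat p \<in> I" unfolding I_def by blast
    then show ?thesis using M(2) by blast
  qed
  have N_notin: "of_nat N \<notin> M"
  proof
    assume "of_nat N \<in> M"
    moreover have "of_nat n \<in> M"
      unfolding n using e ring_ideal_mult_right[OF M(1) p_in] by (cases e) auto
    ultimately have "of_nat n - of_nat N \<in> M" using M(1) ring_ideal_diff by blast
    then show False using M(3) by (simp add: N(2))
  qed
  have X_N: "X ^ N - 1 \<in> M" by (rule kernel) (simp add: \<phi>_hom \<phi>_X zeta_N)
  have X_notin: "X ^ i \<notin> M" for i
  proof
    assume "X ^ i \<in> M"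
    then have "X \<in> M" using M(3) M_prime by (induction i) auto
    then have "X ^ N \<in> M" using N(1) ring_ideal_mult_right[OF M(1)] by (cases N) auto
    then have "X ^ N - (X ^ N - 1) \<in> M" using ring_ideal_diff[OF M(1) _ X_N] by blast
    then show False using M(3) by simp
  qed
  have X_order: "X ^ d - 1 \<notin> M" if d: "0 < d" "d < N" for d
  proof
    assume d1: "X ^ d - 1 \<in> M"
    have "\<zeta> ^ d \<noteq> \<zeta> ^ 0" using inj_onD[OF zeta_inj, of d 0] d by auto
    then have "\<zeta> ^ d \<noteq> 1" by simp
    moreover have "(\<zeta> ^ d - 1) * (\<Sum>k<N. (\<zeta> ^ d) ^ k) = 0"
    proof -
      have "(\<zeta> ^ d) ^ N = 1" by (metis power_mult mult.commute zeta_N power_one)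
      then show ?thesis using power_diff_1_eq[of "\<zeta> ^ d" N] by simp
    qed
    ultimately have "(\<Sum>k<N. (\<zeta> ^ d) ^ k) = 0" by simp
    then have "\<phi> (\<Sum>k<N. (X ^ d) ^ k) = 0"
    proof -
      have "\<phi> (\<Sum>k<K. (X ^ d) ^ k) = (\<Sum>k<K. (\<zeta> ^ d) ^ k)" for K
        by (induction K) (simp_all add: \<phi>_hom \<phi>_X)
      with \<open>(\<Sum>k<N. (\<zeta> ^ d) ^ k) = 0\<close> show ?thesis by simp
    qed
    then have "(\<Sum>k<N. (X ^ d) ^ k) \<in> M" by (rule kernel)
    \<comment> \<open>If \<open>X\<^sup>d \<equiv> 1\<close>, each of the \<open>N\<close> summands is \<open>1\<close> modulo \<open>M\<close>, which forces \<open>N \<in> M\<close>.\<close>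
    moreover have "(\<Sum>k<N. (X ^ d) ^ k - 1) \<in> M"
      using ring_ideal_cong_power[OF M(1) d1] by (intro ring_ideal_sum M(1)) simp
    ultimately have "(\<Sum>k<N. (X ^ d) ^ k) - (\<Sum>k<N. (X ^ d) ^ k - 1) \<in> M"
      using M(1) ring_ideal_diff by blast
    then show False using N_notin by (simp add: sum_subtractf)
  qed
  have X_inj': "\<not> X ^ i - X ^ j \<in> M" if ij: "i < j" "j < N" for i j
  proof
    assume "X ^ i - X ^ j \<in> M"
    then have "X ^ j - X ^ i \<in> M" by (rule ring_ideal_cong_sym[OF M(1)])
    moreover have "X ^ j - X ^ i = X ^ i * (X ^ (j - i) - 1)"
      using ij by (simp add: algebra_simps power_add[symmetric])
    ultimately have "X ^ (j - i) - 1 \<in> M" using M_prime X_notin by metis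
    then show False using X_order[of "j - i"] ij by simp
  qed
  have X_inj: "i = j" if "X ^ i - X ^ j \<in> M" "i < N" "j < N" for i j
    using X_inj'[of i j] X_inj'[of j i] ring_ideal_cong_sym[OF M(1) that(1)] that
    by (metis linorder_neqE_nat)
  define R where "R = insert 0 ((\<lambda>i. X ^ i) ` {..<N})"
  have "inj_on (\<lambda>i. X ^ i) {..<N}"
    by (rule inj_onI) (use X_inj M(1) in \<open>auto simp: ring_ideal_def\<close>)
  moreover have "0 \<notin> (\<lambda>i. X ^ i) ` {..<N}"
  proof -
    have "0 \<in> M" using M(1) by (simp add: ring_ideal_def)
    then show ?thesis using X_notin by (metis imageE)
  qed
  ultimately have card_R: "card R = n" by (simp add: R_def card_image N(2))
  \<comment> \<open>The solutions of \<open>z\<^sup>n = z\<close> modulo \<open>M\<close>, closed under the operations by Frobenius.\<close>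
  define T where "T = {z. z ^ n - z \<in> M}"
  have T_add: "x + y \<in> T" if "x \<in> T" "y \<in> T" for x y
  proof -
    have "(x + y) ^ n - (x ^ n + y ^ n) \<in> M" 
      unfolding n by (rule frobenius_mod_ideal[OF M(1) p_in p])
    moreover have "(x ^ n + y ^ n) - (x + y) \<in> M"
      using that ring_ideal_cong_add[OF M(1)] by (auto simp: T_def)
    ultimately show ?thesis unfolding T_def using ring_ideal_cong_trans[OF M(1)] by blast
  qed
  have T_mult: "x * y \<in> T" if "x \<in> T" "y \<in> T" for x y
    using that ring_ideal_cong_mult[OF M(1), of "x ^ n" x "y ^ n" y]
    by (simp add: T_def power_mult_distrib)
  have R_sub: "R \<subseteq> T"
  proof
    fix x assume "x \<in> R"
    then consider "x = 0" | i where "x = X ^ i" by (auto simp: R_def)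
    then show "x \<in> T"
    proof cases
      case 1
      then show ?thesis using M(1) n1 by (simp add: T_def ring_ideal_def power_0_left)
    next
      case 2
      have "\<phi> (x ^ n - x) = 0"
        by (simp add: 2 \<phi>_hom \<phi>_X N(2) power_mult[symmetric] mult.commute[of i])
           (simp add: power_mult zeta_N)
      then show ?thesis unfolding T_def using kernel by simp
    qed
  qed
  have rep: "\<exists>x\<in>R. z - x \<in> M" if "z \<in> T" for z
  proof -
    have prod_phi: "\<phi> (\<Prod>i<K. z - X ^ i) = (\<Prod>i<K. \<phi> z - \<zeta> ^ i)" for K
      by (induction K) (simp_all add: \<phi>_hom \<phi>_X)
    \<comment> \<open>In \<open>\<int>[\<zeta>]\<close>, \<open>z\<^sup>n - z\<close> is the product of \<open>z\<close> and all \<open>z - \<zeta>\<^sup>i\<close>; primality picks a factor.\<close>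
    have "\<phi> ((z ^ n - z) - z * (\<Prod>i<N. z - X ^ i)) = 0"
      by (simp add: \<phi>_hom prod_phi prod_minus_roots_of_unity[OF N(1) \<zeta>_def] N(2) algebra_simps)
    from ring_ideal_diff[OF M(1) _ kernel[OF this], of "z ^ n - z"]
    have "z * (\<Prod>i<N. z - X ^ i) \<in> M" using that by (simp add: T_def)
    then consider "z \<in> M" | "(\<Prod>i<N. z - X ^ i) \<in> M" using M_prime by blast
    then show ?thesis
    proof cases
      case 1
      then show ?thesis by (auto simp: R_def)
    next
      case 2
      have "\<exists>i<K. z - X ^ i \<in> M" if "(\<Prod>i<K. z - X ^ i) \<in> M" for K
        using that
      proof (induction K)
        case 0
        then show ?case using M(3) by simp
      next
        case (Suc K)
        then have "(\<Prod>i<K. z - X ^ i) \<in> M \<or> z - X ^ K \<in> M" using M_prime by simp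
        then show ?case using Suc.IH less_Suc_eq by blast
      qed
      from this[OF 2] show ?thesis by (auto simp: R_def)
    qed
  qed
  show thesis
  proof (rule that[OF M(1) M_prime _ card_R])
    show "finite R" by (simp add: R_def)
    show "x = y" if "x \<in> R" "y \<in> R" "x - y \<in> M" for x y
      using that X_inj X_notin ring_ideal_cong_sym[OF M(1) that(3)] by (auto simp: R_def)
    show "\<exists>z\<in>R. x + y - z \<in> M" if "x \<in> R" "y \<in> R" for x y
      using that R_sub by (intro rep T_add) auto
    show "\<exists>z\<in>R. x * y - z \<in> M" if "x \<in> R" "y \<in> R" for x y
      using that R_sub by (intro rep T_mult) auto
  qed
qed

text \<open>
  The classical construction: columns are the points \<open>(x, y)\<close> of the affine plane over the field
  of order \<open>n\<close>, rows are \<open>m\<close> distinct slopes \<open>t\<close>, and the entry is the value \<open>y + t x\<close>, which names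
  the parallel line through the point. Two points on a common line for two slopes coincide, so
  a count shows that all pairs of symbols occur.
\<close>

lemma orthogonal_array_exists:
  assumes n: "primepow n" and m: "2 \<le> m" "m \<le> n"
  shows "\<exists>A. orthogonal_array m n A"
proof (rule finite_field_representatives[OF n])
  fix M R :: "int poly set"
  assume M: "ring_ideal M"
    and M_prime: "\<And>x y. x * y \<in> M \<Longrightarrow> x \<in> M \<or> y \<in> M"
    and R: "finite R" "card R = n"
    and R_inj: "\<And>x y. x \<in> R \<Longrightarrow> y \<in> R \<Longrightarrow> x - y \<in> M \<Longrightarrow> x = y"
    and R_add: "\<And>x y. x \<in> R \<Longrightarrow> y \<in> R \<Longrightarrow> \<exists>z\<in>R. x + y - z \<in> M"
    and R_mult: "\<And>x y. x \<in> R \<Longrightarrow> y \<in> R \<Longrightarrow> \<exists>z\<in>R. x * y - z \<in> M"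
  have n0: "n > 0" using n primepow_gt_0_nat by blast
  obtain s where s: "bij_betw s {0..<n} R"
    using ex_bij_betw_nat_finite[OF R(1)] R(2) by blast
  obtain h where h: "bij_betw h R {1..n}"
    using finite_same_card_bij[OF R(1), of "{1..n}"] R(2) by auto
  have s_in: "s i \<in> R" if "i < n" for i using s that by (auto dest: bij_betw_apply)
  have s_inj: "i = j" if "s i = s j" "i < n" "j < n" for i j
    using s that by (auto simp: bij_betw_def dest: inj_onD)
  have "\<exists>z\<in>R. y + t * x - z \<in> M" if xyt: "x \<in> R" "y \<in> R" "t \<in> R" for x y t
  proof -
    obtain u where u: "u \<in> R" "t * x - u \<in> M" using R_mult[OF xyt(3,1)] by blast
    obtain z where z: "z \<in> R" "y + u - z \<in> M" using R_add[OF xyt(2) u(1)] by blast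
    have "(t * x - u) + (y + u - z) \<in> M" using ring_ideal_add[OF M u(2) z(2)] .
    then show ?thesis using z(1) by (intro bexI[of _ z]) (simp_all add: algebra_simps)
  qed
  then obtain line where line: "\<And>x y t. x \<in> R \<Longrightarrow> y \<in> R \<Longrightarrow> t \<in> R \<Longrightarrow>
      line x y t \<in> R \<and> y + t * x - line x y t \<in> M"
    by metis
  define A where "A = mat m (n ^ 2) (\<lambda>(r, c). h (line (s (c div n)) (s (c mod n)) (s r)))"
  have div_less: "c div n < n" "c mod n < n" if "c < n ^ 2" for c
    using that n0 by (simp_all add: less_mult_imp_div_less power2_eq_square)
  have entry: "A $$ (r, c) = h (line (s (c div n)) (s (c mod n)) (s r))" if "r < m" "c < n ^ 2" for r c
    using that by (simp add: A_def)
  have line_in: "line (s (c div n)) (s (c mod n)) (s r) \<in> R"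
    and line_cong: "s (c mod n) + s r * s (c div n) - line (s (c div n)) (s (c mod n)) (s r) \<in> M"
    if "r < m" "c < n ^ 2" for r c
    using line[of "s (c div n)" "s (c mod n)" "s r"] s_in div_less[OF that(2)] that m(2) by auto
  have same_line: "(s (c mod n) - s (d mod n)) + s r * (s (c div n) - s (d div n)) \<in> M"
    if "A $$ (r, c) = A $$ (r, d)" "r < m" "c < n ^ 2" "d < n ^ 2" for r c d
  proof -
    have "line (s (c div n)) (s (c mod n)) (s r) = line (s (d div n)) (s (d mod n)) (s r)"
      using that entry line_in bij_betw_imp_inj_on[OF h] by (auto dest: inj_onD)
    then have "(s (c mod n) + s r * s (c div n)) - (s (d mod n) + s r * s (d div n)) \<in> M"
      using line_cong[of r c] ring_ideal_cong_sym[OF M line_cong[of r d]] that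
        ring_ideal_cong_trans[OF M] by metis
    then show ?thesis by (simp add: algebra_simps)
  qed
  have pair_inj: "inj_on (\<lambda>c. (A $$ (r, c), A $$ (t, c))) {..<n ^ 2}"
    if rt: "r < m" "t < m" "r \<noteq> t" for r t
  proof (rule inj_onI)
    fix c d assume cd: "c \<in> {..<n ^ 2}" "d \<in> {..<n ^ 2}"
      and "(A $$ (r, c), A $$ (t, c)) = (A $$ (r, d), A $$ (t, d))"
    then have r: "(s (c mod n) - s (d mod n)) + s r * (s (c div n) - s (d div n)) \<in> M"
      and t: "(s (c mod n) - s (d mod n)) + s t * (s (c div n) - s (d div n)) \<in> M"
      using same_line rt by auto
    from ring_ideal_diff[OF M r t] have "(s r - s t) * (s (c div n) - s (d div n)) \<in> M"
      by (simp add: algebra_simps)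
    moreover have "s r - s t \<notin> M" using R_inj s_inj s_in rt m(2) by (metis order_less_le_trans)
    ultimately have "s (c div n) - s (d div n) \<in> M" using M_prime by blast
    then have div_eq: "c div n = d div n" using R_inj s_inj s_in div_less cd by (metis lessThan_iff)
    with r have "s (c mod n) - s (d mod n) \<in> M" by simp
    then have "c mod n = d mod n" using R_inj s_inj s_in div_less cd by (metis lessThan_iff)
    with div_eq show "c = d" by (metis div_mult_mod_eq)
  qed
  have range: "A $$ (r, c) \<in> {1..n}" if "r < m" "c < n ^ 2" for r c
    using entry[OF that] line_in[OF that] bij_betw_apply[OF h] by auto
  have "\<exists>c < n ^ 2. A $$ (r, c) = x \<and> A $$ (t, c) = y"
    if rt: "r < m" "t < m" "r \<noteq> t" and xy: "x \<in> {1..n}" "y \<in> {1..n}" for r t x y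
  proof -
    have "(\<lambda>c. (A $$ (r, c), A $$ (t, c))) ` {..<n ^ 2} = {1..n} \<times> {1..n}"
    proof (rule card_subset_eq)
      show "card ((\<lambda>c. (A $$ (r, c), A $$ (t, c))) ` {..<n ^ 2}) = card ({1..n} \<times> {1..n})"
        using card_image[OF pair_inj[OF rt]] by (simp add: power2_eq_square)
    qed (use range rt in auto)
    moreover have "(x, y) \<in> {1..n} \<times> {1..n}" using xy by blast
    ultimately have "(x, y) \<in> (\<lambda>c. (A $$ (r, c), A $$ (t, c))) ` {..<n ^ 2}" by simp
    then show ?thesis by auto
  qed
  moreover have "A \<in> carrier_mat m (n ^ 2)" by (simp add: A_def)
  ultimately have "orthogonal_array m n A"
    unfolding orthogonal_array_def using m(1) n0 range by auto
  then show ?thesis by blast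
qed

section \<open>Matrices with a rank-one quadratic relation\<close>

lemma sum_diag_mult_commute:
  fixes A B :: "'a :: comm_ring_1 mat"
  assumes "A \<in> carrier_mat n k" "B \<in> carrier_mat k n"
  shows "(\<Sum>i<n. (A * B) $$ (i, i)) = (\<Sum>j<k. (B * A) $$ (j, j))"
proof -
  have "(\<Sum>i<n. (A * B) $$ (i, i)) = (\<Sum>i<n. \<Sum>j<k. A $$ (i, j) * B $$ (j, i))"
    using assms by (auto simp: scalar_prod_def atLeast0LessThan intro!: sum.cong)
  also have "\<dots> = (\<Sum>j<k. \<Sum>i<n. B $$ (j, i) * A $$ (i, j))"
    by (subst sum.swap) (simp add: mult.commute)
  also have "\<dots> = (\<Sum>j<k. (B * A) $$ (j, j))"
    using assms by (auto simp: scalar_prod_def atLeast0LessThan intro!: sum.cong)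
  finally show ?thesis .
qed

text \<open>
  The trace of a matrix and of its square in terms of the eigenvalues, read off from a Schur
  decomposition.
\<close>

lemma sum_diag_eq_sum_eigenvalues:
  fixes A :: "'a :: conjugatable_ordered_field mat"
  assumes A: "A \<in> carrier_mat n n" and cp: "char_poly A = (\<Prod>a\<leftarrow>as. [:- a, 1:])"
  shows "(\<Sum>i<n. A $$ (i, i)) = (\<Sum>a\<leftarrow>as. a)"
    and "(\<Sum>i<n. (A * A) $$ (i, i)) = (\<Sum>a\<leftarrow>as. a * a)"
proof -
  obtain B P Q where dec: "schur_decomposition A as = (B, P, Q)" by (metis prod_cases3)
  have wit: "similar_mat_wit A B P Q" and ut: "upper_triangular B" and diag: "diag_mat B = as"
    using schur_decomposition[OF A cp dec] by auto
  note [simp] = similar_mat_witD2(4-7)[OF A wit]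
  note QP = similar_mat_witD2(2)[OF A wit] and A_eq = similar_mat_witD2(3)[OF A wit]
  have diag_eq: "(\<Sum>i<n. (P * C * Q) $$ (i, i)) = (\<Sum>i<n. C $$ (i, i))"
    if C: "C \<in> carrier_mat n n" for C
  proof -
    have "(\<Sum>i<n. (P * C * Q) $$ (i, i)) = (\<Sum>i<n. (Q * (P * C)) $$ (i, i))"
      using C by (intro sum_diag_mult_commute mult_carrier_mat) auto
    also have "Q * (P * C) = C"
      using C QP by (simp add: assoc_mult_mat[symmetric, of Q n n P n C n])
    finally show ?thesis .
  qed
  have sum_diag: "(\<Sum>i<n. f (B $$ (i, i))) = (\<Sum>a\<leftarrow>as. f a)" for f :: "'a \<Rightarrow> 'a"
    using carrier_matD(1)[OF similar_mat_witD2(5)[OF A wit]]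
    by (simp add: diag[symmetric] diag_mat_def sum_list_sum_nth atLeast0LessThan)
  show "(\<Sum>i<n. A $$ (i, i)) = (\<Sum>a\<leftarrow>as. a)"
    using diag_eq[of B] sum_diag[of "\<lambda>a. a"] by (simp add: A_eq)
  have "A * A = P * (B * B) * Q"
  proof -
    have [simp]: "X * Y \<in> carrier_mat n n" if "X \<in> carrier_mat n n" "Y \<in> carrier_mat n n" for X Y :: "'a mat"
      using that by (rule mult_carrier_mat)
    have "A * A = P * B * (Q * (P * (B * Q)))"
      by (simp add: A_eq assoc_mult_mat[of _ n n _ n _ n])
    also have "Q * (P * (B * Q)) = B * Q"
      using QP left_mult_one_mat[of "B * Q" n n]
      by (simp add: assoc_mult_mat[symmetric, of Q n n P n "B * Q" n])
    also have "P * B * (B * Q) = P * (B * B) * Q"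
      by (simp add: assoc_mult_mat[of _ n n _ n _ n])
    finally show ?thesis .
  qed
  moreover have "(B * B) $$ (i, i) = B $$ (i, i) * B $$ (i, i)" if i: "i < n" for i
  proof -
    have B: "dim_row B = n" "dim_col B = n"
      by (rule carrier_matD[OF similar_mat_witD2(5)[OF A wit]])+
    have "(B * B) $$ (i, i) = (\<Sum>k<n. B $$ (i, k) * B $$ (k, i))"
      using i B by (auto simp: scalar_prod_def atLeast0LessThan)
    also have "\<dots> = (\<Sum>k\<in>{i}. B $$ (i, k) * B $$ (k, i))"
    proof (rule sum.mono_neutral_right)
      show "\<forall>k\<in>{..<n} - {i}. B $$ (i, k) * B $$ (k, i) = 0"
      proof
        fix k assume "k \<in> {..<n} - {i}"
        then have "k < i \<or> i < k" "k < n" by auto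
        then show "B $$ (i, k) * B $$ (k, i) = 0"
          using upper_triangularD[OF ut, of k i] upper_triangularD[OF ut, of i k] i B by auto
      qed
    qed (use i in auto)
    finally show ?thesis by simp
  qed
  ultimately show "(\<Sum>i<n. (A * A) $$ (i, i)) = (\<Sum>a\<leftarrow>as. a * a)"
    using diag_eq[of "B * B"] sum_diag[of "\<lambda>a. a * a"] by (simp add: mult_carrier_mat[of B n n B n])
qed

text \<open>
  The hypotheses say \<open>(A - y)(A - z) = c w w\<^sup>T\<close> and \<open>A w = x w\<close>. Hence \<open>(A - x)(A - y)(A - z) = 0\<close>.
  Complex eigenvalues are treated, so no spectral theorem for symmetric matrices is involved.
\<close>

lemma eigenvalue_of_rank_one_quadratic:
  fixes A :: "real mat" and w :: "nat \<Rightarrow> real" and \<mu> :: complex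
  assumes A: "A \<in> carrier_mat n n"
    and quad: "\<And>i j. i < n \<Longrightarrow> j < n \<Longrightarrow> (\<Sum>k<n. A $$ (i, k) * A $$ (k, j))
      = (y + z) * A $$ (i, j) - y * z * of_bool (i = j) + c * w i * w j"
    and eig: "\<And>i. i < n \<Longrightarrow> (\<Sum>j<n. A $$ (i, j) * w j) = x * w i"
    and ev: "eigenvalue (map_mat complex_of_real A) \<mu>"
  shows "\<mu> \<in> {of_real x, of_real y, of_real z}"
proof -
  let ?A = "\<lambda>i j. complex_of_real (A $$ (i, j))"
  let ?w = "\<lambda>i. complex_of_real (w i)"
  obtain v where v: "v \<in> carrier_vec n" "v \<noteq> 0\<^sub>v n" and Av: "map_mat complex_of_real A *\<^sub>v v = \<mu> \<cdot>\<^sub>v v"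
    using ev A by (auto simp: eigenvalue_def eigenvector_def)
  have A_v: "(\<Sum>j<n. ?A i j * v $ j) = \<mu> * v $ i" if i: "i < n" for i
  proof -
    have "(\<Sum>j<n. ?A i j * v $ j) = (map_mat complex_of_real A *\<^sub>v v) $ i"
      using i A v(1) by (auto simp: scalar_prod_def atLeast0LessThan intro!: sum.cong)
    also have "\<dots> = \<mu> * v $ i" unfolding Av using i v(1) by simp
    finally show ?thesis .
  qed
  define s where "s = (\<Sum>j<n. ?w j * v $ j)"
  define f where "f = (\<mu> - of_real y) * (\<mu> - of_real z)"
  have f_v: "f * v $ i = of_real c * s * ?w i" if i: "i < n" for i
  proof -
    have "\<mu> * (\<mu> * v $ i) = (\<Sum>k<n. ?A i k * (\<mu> * v $ k))"
      using A_v[OF i] by (simp add: sum_distrib_left mult_ac flip: A_v[OF i])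
    also have "\<dots> = (\<Sum>k<n. ?A i k * (\<Sum>j<n. ?A k j * v $ j))"
      using A_v by (intro sum.cong refl) simp
    also have "\<dots> = (\<Sum>j<n. (\<Sum>k<n. ?A i k * ?A k j) * v $ j)"
      by (simp add: sum_distrib_left sum_distrib_right mult_ac) (rule sum.swap)
    also have "\<dots> = (\<Sum>j<n. of_real ((y + z) * A $$ (i, j) - y * z * of_bool (i = j) + c * w i * w j) * v $ j)"
    proof (rule sum.cong[OF refl])
      fix j assume "j \<in> {..<n}"
      then show "(\<Sum>k<n. ?A i k * ?A k j) * v $ j
          = of_real ((y + z) * A $$ (i, j) - y * z * of_bool (i = j) + c * w i * w j) * v $ j"
        using quad[OF i, of j] by (simp flip: of_real_mult of_real_sum)
    qed
    also have "\<dots> = (\<Sum>j<n. of_real (y + z) * (?A i j * v $ j)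
        - of_real (y * z) * (of_bool (i = j) * v $ j) + of_real c * ?w i * (?w j * v $ j))"
      by (intro sum.cong refl) (auto simp: algebra_simps)
    also have "\<dots> = of_real (y + z) * (\<Sum>j<n. ?A i j * v $ j)
        - of_real (y * z) * (\<Sum>j<n. of_bool (i = j) * v $ j) + of_real c * ?w i * s"
      by (simp add: s_def sum.distrib sum_subtractf flip: sum_distrib_left)
    also have "(\<Sum>j<n. of_bool (i = j) * v $ j) = v $ i"
      using i by (simp add: of_bool_def if_distrib[of "\<lambda>a. a * _"] sum.delta cong: if_cong)
    also have "(\<Sum>j<n. ?A i j * v $ j) = \<mu> * v $ i" by (rule A_v[OF i])
    finally show ?thesis by (simp add: f_def algebra_simps)
  qed
  obtain i where i: "i < n" "v $ i \<noteq> 0"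
    using v by (metis carrier_vecD eq_vecI index_zero_vec)
  have "\<mu> * (f * v $ i) = (\<Sum>j<n. ?A i j * (f * v $ j))"
  proof -
    have "\<mu> * (f * v $ i) = f * (\<Sum>j<n. ?A i j * v $ j)" using A_v[OF i(1)] by simp
    then show ?thesis by (simp add: sum_distrib_left mult_ac)
  qed
  also have "\<dots> = (\<Sum>j<n. ?A i j * (of_real c * s * ?w j))"
    using f_v by (intro sum.cong refl) simp
  also have "\<dots> = of_real c * s * of_real (\<Sum>j<n. A $$ (i, j) * w j)"
    by (simp add: sum_distrib_left mult_ac)
  also have "\<dots> = of_real x * (f * v $ i)" using eig[OF i(1)] f_v[OF i(1)] by simp
  finally have "(\<mu> - of_real x) * f = 0" using i(2) by auto
  then show ?thesis by (auto simp: f_def)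
qed

lemma char_poly_splits_over_reals:
  fixes A :: "real mat"
  assumes A: "A \<in> carrier_mat n n"
    and real: "\<And>\<mu>. eigenvalue (map_mat complex_of_real A) \<mu> \<Longrightarrow> \<mu> \<in> complex_of_real ` S"
  obtains bs where "set bs \<subseteq> S" "length bs = n" "char_poly A = (\<Prod>b\<leftarrow>bs. [:- b, 1:])"
proof -
  let ?A = "map_mat complex_of_real A"
  have cA: "?A \<in> carrier_mat n n" using A by simp
  obtain as where as: "char_poly ?A = (\<Prod>a\<leftarrow>as. [:- a, 1:])" "length as = n"
    using char_poly_factorized[OF cA] by blast
  have "set as \<subseteq> complex_of_real ` S"
  proof
    fix a assume "a \<in> set as"
    then have "poly (char_poly ?A) a = 0"
      by (auto simp: as(1) poly_prod_list o_def prod_list_zero_iff)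
    then show "a \<in> complex_of_real ` S" using real eigenvalue_root_char_poly[OF cA] by blast
  qed
  then obtain bs where bs: "as = map complex_of_real bs" "set bs \<subseteq> S"
  proof (induction as arbitrary: thesis)
    case Nil
    then show ?case by simp
  next
    case (Cons a as)
    then obtain bs where "as = map complex_of_real bs" "set bs \<subseteq> S" by (metis insert_subset list.simps(15))
    moreover obtain b where "a = complex_of_real b" "b \<in> S" using Cons.prems(2) by auto
    ultimately show ?case using Cons.prems(1)[of "b # bs"] by simp
  qed
  interpret real_poly: map_poly_inj_comm_ring_hom complex_of_real ..
  have "map_poly complex_of_real (\<Prod>b\<leftarrow>bs. [:- b, 1:]) = (\<Prod>a\<leftarrow>as. [:- a, 1:])"
    unfolding bs(1) by (induction bs) (simp_all add: real_poly.hom_mult del: mult_pCons_left)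
  also have "\<dots> = map_poly complex_of_real (char_poly A)"
    using of_real_hom.char_poly_hom[OF A, where 'a = complex] as(1) by simp
  finally have "char_poly A = (\<Prod>b\<leftarrow>bs. [:- b, 1:])" by simp
  with bs as(2) show thesis by (intro that[of bs]) auto
qed

lemma sum_list_three_values:
  fixes f :: "'a \<Rightarrow> real"
  assumes "set bs \<subseteq> {x, y, z}" "x \<noteq> y" "x \<noteq> z" "y \<noteq> z"
  shows "(\<Sum>b\<leftarrow>bs. f b) = real (count (mset bs) x) * f x + real (count (mset bs) y) * f y
    + real (count (mset bs) z) * f z"
  using assms(1) by (induction bs) (use assms(2-) in \<open>auto simp: algebra_simps\<close>)

text \<open>
  The multiplicity of \<open>x\<close> is \<open>1\<close> because the trace of \<open>(A - y)(A - z) = c w w\<^sup>T\<close> is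
  \<open>(x - y)(x - z)\<close>; the size and the trace of \<open>A\<close> then determine the other two multiplicities.
\<close>

lemma proots_char_poly_rank_one_quadratic:
  fixes A :: "real mat" and w :: "nat \<Rightarrow> real"
  assumes A: "A \<in> carrier_mat n n"
    and quad: "\<And>i j. i < n \<Longrightarrow> j < n \<Longrightarrow> (\<Sum>k<n. A $$ (i, k) * A $$ (k, j))
      = (y + z) * A $$ (i, j) - y * z * of_bool (i = j) + c * w i * w j"
    and eig: "\<And>i. i < n \<Longrightarrow> (\<Sum>j<n. A $$ (i, j) * w j) = x * w i"
    and distinct: "x \<noteq> y" "x \<noteq> z" "y \<noteq> z"
    and norm: "c * (\<Sum>i<n. w i * w i) = (x - y) * (x - z)"
    and trace: "(\<Sum>i<n. A $$ (i, i)) = x + real k * y + real l * z"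
    and n: "n = Suc (k + l)"
  shows "proots (char_poly A) = {#x#} + replicate_mset k y + replicate_mset l z"
proof -
  have "\<mu> \<in> complex_of_real ` {x, y, z}" if "eigenvalue (map_mat complex_of_real A) \<mu>" for \<mu>
    using eigenvalue_of_rank_one_quadratic[OF A quad eig that] by auto
  then obtain bs where bs: "set bs \<subseteq> {x, y, z}" "length bs = n"
    and cp: "char_poly A = (\<Prod>b\<leftarrow>bs. [:- b, 1:])"
    using char_poly_splits_over_reals[OF A] by metis
  define X Y Z where "X = count (mset bs) x" and "Y = count (mset bs) y" and "Z = count (mset bs) z"
  note three = sum_list_three_values[OF bs(1) distinct, folded X_def Y_def Z_def]
  have size: "real n = real X + real Y + real Z"
    using three[of "\<lambda>_. 1"] bs(2) by (simp add: sum_list_triv)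
  have tr: "(\<Sum>i<n. A $$ (i, i)) = real X * x + real Y * y + real Z * z"
    using sum_diag_eq_sum_eigenvalues(1)[OF A cp] three[of "\<lambda>b. b"] by simp
  have "(\<Sum>i<n. (A * A) $$ (i, i)) = (\<Sum>i<n. \<Sum>k<n. A $$ (i, k) * A $$ (k, i))"
    using A by (auto simp: scalar_prod_def atLeast0LessThan intro!: sum.cong)
  also have "\<dots> = (\<Sum>i<n. (y + z) * A $$ (i, i) - y * z + c * w i * w i)"
    using quad by (intro sum.cong) auto
  also have "\<dots> = (y + z) * (\<Sum>i<n. A $$ (i, i)) - real n * (y * z) + c * (\<Sum>i<n. w i * w i)"
    by (simp add: sum.distrib sum_subtractf sum_distrib_left mult_ac)
  finally have "real X * (x * x) + real Y * (y * y) + real Z * (z * z)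
      = (y + z) * (real X * x + real Y * y + real Z * z) - (real X + real Y + real Z) * (y * z)
        + (x - y) * (x - z)"
    using sum_diag_eq_sum_eigenvalues(2)[OF A cp] three[of "\<lambda>b. b * b"] tr size norm by simp
  then have "(real X - 1) * ((x - y) * (x - z)) = 0" by (simp add: algebra_simps)
  then have X1: "X = 1" using distinct by simp
  have "real Y + real Z = real k + real l" using size X1 n by simp
  moreover have "real Y * y + real Z * z = real k * y + real l * z" using tr trace X1 by simp
  moreover from calculation(1) have "real Z = real k + real l - real Y" by simp
  ultimately have "(real Y - real k) * (y - z) = 0" by (simp add: algebra_simps)
  then have Y: "Y = k" using distinct by simp
  then have Z: "Z = l" using size X1 n by simp
  have "proots (char_poly A) = mset bs"
  proof -
    have "[:- b, 1:] \<noteq> 0" for b :: real by simp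
    then have "proots (\<Prod>b\<leftarrow>bs. [:- b, 1:]) = mset bs"
    proof (induction bs)
      case (Cons b bs)
      have "(\<Prod>b\<leftarrow>bs. [:- b, 1:]) \<noteq> 0" by (auto simp: prod_list_zero_iff)
      then show ?case using Cons by (simp add: proots_mult del: mult_pCons_left)
    qed simp
    then show ?thesis by (simp add: cp)
  qed
  also have "\<dots> = {#x#} + replicate_mset k y + replicate_mset l z"
  proof (rule multiset_eqI)
    fix t
    show "count (mset bs) t = count ({#x#} + replicate_mset k y + replicate_mset l z) t"
    proof (cases "t \<in> {x, y, z}")
      case True
      then show ?thesis using X1 Y Z distinct by (auto simp: X_def Y_def Z_def)
    next
      case False
      then have "t \<notin># mset bs" using bs(1) by auto
      then show ?thesis using False by (auto simp: count_eq_zero_iff not_in_iff)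
    qed
  qed
  finally show ?thesis .
qed

section \<open>The adjacency matrix of a switched block graph\<close>

text \<open>
  The polynomial identity behind \<open>(B - y)(B - z) = 3/4 w w\<^sup>T\<close> for the switched matrix \<open>B\<close>: here
  \<open>S\<close>, \<open>T\<close> are the signs of two columns, \<open>a\<close> their adjacency, \<open>\<delta>\<close> the Kronecker symbol, and \<open>E\<close> the
  excess. The hypothesis on \<open>E\<^sup>2\<close> is what makes the right-hand side factor.
\<close>

lemma rank_one_identity:
  fixes S T E a \<delta> n m :: real
  assumes "S * S = 1" "T * T = 1" "S * T * \<delta> = \<delta>" "E * E = n * (n + 2) / 3" "m = (n - 1) / 2"
  shows "n\<^sup>2 / 4 + T / 2 * (((n - m) * T + (m - 1) * E) - n * E / 2)
    + S / 2 * (((n - m) * S + (m - 1) * E) - n * E / 2)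
    + S * T * ((n - 2 * m) * a + m * (m - 1) + m * (n - m) * \<delta> - m * (n - 1) + n\<^sup>2 / 4)
   = ((n + 1) / 2 + (1 - n) / 2) * (1 / 2 + S * T * (a - 1 / 2)) - (n + 1) / 2 * ((1 - n) / 2) * \<delta>
     + 3 / 4 * (S - E) * (T - E)" (is "?L = ?R")
proof -
  have "?L - ?R = (n + 1) / 4 * (T * T - 1) + (n + 1) / 4 * (S * S - 1)
      + (n\<^sup>2 - 1) / 4 * (S * T * \<delta> - \<delta>) - 3 / 4 * (E * E - n * (n + 2) / 3)"
    unfolding assms(5) by (simp add: field_simps power2_eq_square)
  then show ?thesis using assms(1-4) by simp
qed

lemma eigenvector_identity:
  fixes S E n m :: real
  assumes "S * S = 1" "E * E = n * (n + 2) / 3" "m = (n - 1) / 2"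
  shows "n * E / 2 + S * (m * (n - 1) - n\<^sup>2 / 2)
    - E * (n\<^sup>2 / 2 + S * (((n - m) * S + (m - 1) * E) - n * E / 2)) = (n\<^sup>2 + 1) / 2 * (S - E)" (is "?L = ?R")
proof -
  have "?L - ?R = 3 / 2 * S * (E * E - n * (n + 2) / 3) - (n + 1) / 2 * E * (S * S - 1)"
    unfolding assms(3) by (simp add: field_simps power2_eq_square)
  then show ?thesis using assms(1-2) by simp
qed

lemma three_values_distinct:
  fixes r :: real
  assumes "1 < r"
  shows "(r\<^sup>2 + 1) / 2 \<noteq> (r + 1) / 2" "(r\<^sup>2 + 1) / 2 \<noteq> (1 - r) / 2" "(r + 1) / 2 \<noteq> (1 - r) / 2"
proof -
  have "r < r\<^sup>2" using assms by (simp add: power2_eq_square)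
  then have "(r + 1) / 2 < (r\<^sup>2 + 1) / 2" by simp
  moreover have "(1 - r) / 2 < (r + 1) / 2" using assms by simp
  ultimately show "(r\<^sup>2 + 1) / 2 \<noteq> (r + 1) / 2" "(r\<^sup>2 + 1) / 2 \<noteq> (1 - r) / 2" "(r + 1) / 2 \<noteq> (1 - r) / 2"
    by (metis order.strict_trans less_irrefl)+
qed

lemma orthogonal_array_pair_bij:
  assumes A: "orthogonal_array m n A" and rs: "r < m" "s < m" "r \<noteq> s"
  shows "bij_betw (\<lambda>c. (A $$ (r, c), A $$ (s, c))) {..<n ^ 2} ({1..n} \<times> {1..n})"
proof -
  have sub: "(\<lambda>c. (A $$ (r, c), A $$ (s, c))) ` {..<n ^ 2} = {1..n} \<times> {1..n}"
  proof (intro subset_antisym subsetI)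
    fix z assume "z \<in> {1..n} \<times> {1..n}"
    then obtain x y where z: "z = (x, y)" "x \<in> {1..n}" "y \<in> {1..n}" by blast
    then obtain c where "c < n ^ 2" "A $$ (r, c) = x" "A $$ (s, c) = y"
      using A rs unfolding orthogonal_array_def by blast
    then show "z \<in> (\<lambda>c. (A $$ (r, c), A $$ (s, c))) ` {..<n ^ 2}"
      using z(1) by (auto intro!: image_eqI[of _ _ c])
  qed (use A rs in \<open>auto simp: orthogonal_array_def\<close>)
  moreover have "inj_on (\<lambda>c. (A $$ (r, c), A $$ (s, c))) {..<n ^ 2}"
    by (rule eq_card_imp_inj_on) (use sub in \<open>simp_all add: power2_eq_square\<close>)
  ultimately show ?thesis by (simp add: bij_betw_def)
qed

text \<open>
  Two different rows behave like independent uniform coordinates; all counts needed for the block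
  graph are instances of this identity.
\<close>

lemma orthogonal_array_sum_pair:
  fixes f g :: "nat \<Rightarrow> real"
  assumes A: "orthogonal_array m n A" and rs: "r < m" "s < m" "r \<noteq> s"
  shows "(\<Sum>c<n ^ 2. f (A $$ (r, c)) * g (A $$ (s, c))) = (\<Sum>x=1..n. f x) * (\<Sum>y=1..n. g y)"
proof -
  have "(\<Sum>c<n ^ 2. f (A $$ (r, c)) * g (A $$ (s, c))) = (\<Sum>(x, y)\<in>{1..n} \<times> {1..n}. f x * g y)"
    using sum.reindex_bij_betw[OF orthogonal_array_pair_bij[OF A rs], of "\<lambda>(x, y). f x * g y"]
    by simp
  then show ?thesis by (simp add: sum.cartesian_product sum_product)
qed

lemma orthogonal_array_sum_single:
  fixes f :: "nat \<Rightarrow> real"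
  assumes A: "orthogonal_array m n A" and r: "r < m"
  shows "(\<Sum>c<n ^ 2. f (A $$ (r, c))) = real n * (\<Sum>x=1..n. f x)"
proof -
  have "2 \<le> m" using A by (simp add: orthogonal_array_def)
  then have "\<exists>s<m. r \<noteq> s" by (intro exI[of _ "if r = 0 then 1 else 0"]) auto
  then obtain s where "s < m" "r \<noteq> s" by blast
  then show ?thesis using orthogonal_array_sum_pair[OF A r, of s f "\<lambda>_. 1"] by simp
qed

lemma sum_delta:
  fixes g :: "nat \<Rightarrow> real"
  assumes "c < k"
  shows "(\<Sum>e<k. of_bool (c = e) * g e) = g c" and "(\<Sum>e<k. g e * of_bool (e = c)) = g c"
proof -
  have "(\<Sum>e<k. of_bool (c = e) * g e) = (\<Sum>e<k. if e = c then g e else 0)"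
    by (intro sum.cong) auto
  then show "(\<Sum>e<k. of_bool (c = e) * g e) = g c" using assms by simp
  have "(\<Sum>e<k. g e * of_bool (e = c)) = (\<Sum>e<k. if e = c then g e else 0)"
    by (intro sum.cong) auto
  then show "(\<Sum>e<k. g e * of_bool (e = c)) = g c" using assms by simp
qed

text \<open>
  An orthogonal array together with the number \<open>N\<close> of row cliques that are switched. No relation
  between \<open>m\<close>, \<open>n\<close> and \<open>N\<close> is imposed beyond \<open>N \<le> n\<close>.
\<close>

locale block_switching =
  fixes m n N :: nat and A :: "nat mat"
  assumes A: "orthogonal_array m n A" and N: "N \<le> n"
begin

lemma m_ge_2: "2 \<le> m" and n_ge_1: "1 \<le> n" and carrier: "A \<in> carrier_mat m (n ^ 2)"
  using A by (auto simp: orthogonal_array_def)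

lemma entry: "r < m \<Longrightarrow> c < n ^ 2 \<Longrightarrow> A $$ (r, c) \<in> {1..n}"
  using A by (auto simp: orthogonal_array_def)

text \<open>
  The number of rows in which two columns agree; this is \<open>m\<close> if the columns are equal, and otherwise
  at most \<open>1\<close>.
\<close>

definition agreements :: "nat \<Rightarrow> nat \<Rightarrow> real" where
  "agreements c d = (\<Sum>r<m. of_bool (A $$ (r, c) = A $$ (r, d)))"

text \<open>
  The adjacency matrix of the block graph, as a function of two column indices (see \<open>adj_eq\<close>).
\<close>

definition adj :: "nat \<Rightarrow> nat \<Rightarrow> real" where
  "adj c d = agreements c d - real m * of_bool (c = d)"

text \<open>
  The diagonal \<open>\<plusminus>1\<close> matrix of the switching: \<open>1\<close> on the first \<open>N\<close> row cliques, \<open>- 1\<close> elsewhere.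
\<close>

definition side :: "nat \<Rightarrow> real" where
  "side c = (if A $$ (0, c) \<le> N then 1 else - 1)"

text \<open>
  The sum of the signs over the \<open>n\<close> symbols of the first row.
\<close>

definition excess :: real where
  "excess = 2 * real N - real n"

lemma side_square: "side c * side c = 1" by (simp add: side_def)

lemma agreements_sym: "agreements c d = agreements d c"
  unfolding agreements_def by (intro sum.cong) auto

lemma adj_sym: "adj c d = adj d c"
  unfolding adj_def using agreements_sym[of c d] by auto

lemma adj_eq:
  assumes "c < n ^ 2" "d < n ^ 2"
  shows "adj c d = of_bool (c \<noteq> d \<and> (\<exists>r<m. A $$ (r, c) = A $$ (r, d)))"
proof (cases "c = d")
  case True
  then show ?thesis by (simp add: adj_def agreements_def)
next
  case False
  have unique: "r = s" if "r < m" "s < m" "A $$ (r, c) = A $$ (r, d)" "A $$ (s, c) = A $$ (s, d)" for r s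
    using bij_betw_imp_inj_on[OF orthogonal_array_pair_bij[OF A that(1,2)]] that assms False
    by (auto dest: inj_onD)
  show ?thesis
  proof (cases "\<exists>r<m. A $$ (r, c) = A $$ (r, d)")
    case True
    then obtain r where r: "r < m" "A $$ (r, c) = A $$ (r, d)" by blast
    have "agreements c d = (\<Sum>s<m. if s = r then 1 else 0)"
      unfolding agreements_def using unique r by (intro sum.cong) auto
    then show ?thesis using False True r(1) by (simp add: adj_def)
  next
    case no: False
    then show ?thesis using False by (simp add: adj_def agreements_def)
  qed
qed

lemma sum_sides: "(\<Sum>x=1..n. if x \<le> N then 1 else - 1 :: real) = excess"
proof -
  have "{1..n} \<inter> {x. x \<le> N} = {1..N}" "{1..n} \<inter> - {x. x \<le> N} = {N<..n}" using N by auto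
  then show ?thesis using N by (simp add: sum.If_cases excess_def of_nat_diff)
qed

lemma sum_side: "(\<Sum>c<n ^ 2. side c) = real n * excess"
  using orthogonal_array_sum_single[OF A, of 0 "\<lambda>x. if x \<le> N then 1 else - 1"] m_ge_2 sum_sides
  by (simp add: side_def)

lemma sum_indicator:
  assumes "r < m" "c < n ^ 2"
  shows "(\<Sum>x=1..n. of_bool (A $$ (r, c) = x) :: real) = 1"
    and "(\<Sum>x=1..n. of_bool (x = A $$ (r, c)) :: real) = 1"
  using entry[OF assms] by (simp_all add: of_bool_def sum.delta sum.delta')

lemma sum_agreements:
  assumes c: "c < n ^ 2"
  shows "(\<Sum>e<n ^ 2. agreements c e) = real m * real n"
proof -
  have "(\<Sum>e<n ^ 2. agreements c e) = (\<Sum>r<m. \<Sum>e<n ^ 2. of_bool (A $$ (r, c) = A $$ (r, e)))"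
    unfolding agreements_def by (rule sum.swap)
  also have "\<dots> = (\<Sum>r<m. real n)"
  proof (rule sum.cong[OF refl])
    fix r assume "r \<in> {..<m}"
    then have "r < m" by simp
    then show "(\<Sum>e<n ^ 2. of_bool (A $$ (r, c) = A $$ (r, e))) = real n"
      using orthogonal_array_sum_single[OF A, of r "\<lambda>x. of_bool (A $$ (r, c) = x)"]
        sum_indicator(1)[OF _ c, of r] by simp
  qed
  finally show ?thesis by simp
qed

lemma sum_agreements_side:
  assumes c: "c < n ^ 2"
  shows "(\<Sum>e<n ^ 2. agreements c e * side e) = real n * side c + (real m - 1) * excess"
proof -
  let ?f = "\<lambda>x. if x \<le> N then 1 else - 1 :: real"
  have row: "(\<Sum>e<n ^ 2. of_bool (A $$ (r, c) = A $$ (r, e)) * side e)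
      = (if r = 0 then real n * side c else excess)" if r: "r < m" for r
  proof (cases "r = 0")
    case True
    have "(\<Sum>e<n ^ 2. of_bool (A $$ (r, c) = A $$ (r, e)) * side e)
        = (\<Sum>e<n ^ 2. of_bool (A $$ (0, c) = A $$ (0, e)) * ?f (A $$ (0, c)))"
      unfolding side_def True by (intro sum.cong) auto
    also have "\<dots> = real n * side c"
      using orthogonal_array_sum_single[OF A, of 0 "\<lambda>x. of_bool (A $$ (0, c) = x)"]
        sum_indicator(1)[OF _ c, of 0] r True
      by (simp add: side_def sum_distrib_right[symmetric] del: sum_distrib_right)
    finally show ?thesis using True by simp
  next
    case False
    have "(\<Sum>e<n ^ 2. of_bool (A $$ (r, c) = A $$ (r, e)) * side e)
        = (\<Sum>x=1..n. of_bool (A $$ (r, c) = x)) * (\<Sum>y=1..n. ?f y)"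
      unfolding side_def by (rule orthogonal_array_sum_pair[OF A r]) (use m_ge_2 False in auto)
    then show ?thesis using False sum_indicator(1)[OF r c] sum_sides by simp
  qed
  have "(\<Sum>e<n ^ 2. agreements c e * side e)
      = (\<Sum>r<m. \<Sum>e<n ^ 2. of_bool (A $$ (r, c) = A $$ (r, e)) * side e)"
    unfolding agreements_def by (subst sum.swap) (simp add: sum_distrib_right)
  also have "\<dots> = (\<Sum>r<m. if r = 0 then real n * side c else excess)"
    using row by (intro sum.cong) auto
  also have "\<dots> = (\<Sum>r<m. excess + (if r = 0 then real n * side c - excess else 0))"
    by (intro sum.cong) auto
  also have "\<dots> = real n * side c + (real m - 1) * excess"
    using m_ge_2 by (simp add: sum.distrib algebra_simps)
  finally show ?thesis .
qed

lemma sum_agreements_agreements: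
  assumes c: "c < n ^ 2" and d: "d < n ^ 2"
  shows "(\<Sum>e<n ^ 2. agreements c e * agreements e d)
    = real n * agreements c d + real m * (real m - 1)"
proof -
  have rows: "(\<Sum>e<n ^ 2. of_bool (A $$ (r, c) = A $$ (r, e)) * of_bool (A $$ (s, e) = A $$ (s, d)))
      = (if s = r then real n * of_bool (A $$ (r, c) = A $$ (r, d)) else 1 :: real)"
    if r: "r < m" and s: "s < m" for r s
  proof (cases "s = r")
    case True
    have "(\<Sum>e<n ^ 2. of_bool (A $$ (r, c) = A $$ (r, e)) * of_bool (A $$ (s, e) = A $$ (s, d)))
        = (\<Sum>e<n ^ 2. of_bool (A $$ (r, c) = A $$ (r, e)) * of_bool (A $$ (r, c) = A $$ (r, d)) :: real)"
      unfolding True by (intro sum.cong) auto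
    also have "\<dots> = (\<Sum>e<n ^ 2. of_bool (A $$ (r, c) = A $$ (r, e))) * of_bool (A $$ (r, c) = A $$ (r, d))"
      by (rule sum_distrib_right[symmetric])
    also have "\<dots> = real n * of_bool (A $$ (r, c) = A $$ (r, d))"
      using orthogonal_array_sum_single[OF A r, of "\<lambda>x. of_bool (A $$ (r, c) = x)"] sum_indicator(1)[OF r c]
      by simp
    finally show ?thesis using True by simp
  next
    case False
    have "(\<Sum>e<n ^ 2. of_bool (A $$ (r, c) = A $$ (r, e)) * of_bool (A $$ (s, e) = A $$ (s, d)))
        = (\<Sum>x=1..n. of_bool (A $$ (r, c) = x)) * (\<Sum>y=1..n. of_bool (y = A $$ (s, d)) :: real)"
      by (rule orthogonal_array_sum_pair[OF A r s]) (use False in auto)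
    then show ?thesis using False sum_indicator(1)[OF r c] sum_indicator(2)[OF s d] by simp
  qed
  have "(\<Sum>e<n ^ 2. agreements c e * agreements e d)
      = (\<Sum>e<n ^ 2. \<Sum>r<m. \<Sum>s<m. of_bool (A $$ (r, c) = A $$ (r, e)) * of_bool (A $$ (s, e) = A $$ (s, d)))"
    unfolding agreements_def sum_product ..
  also have "\<dots> = (\<Sum>r<m. \<Sum>e<n ^ 2. \<Sum>s<m. of_bool (A $$ (r, c) = A $$ (r, e)) * of_bool (A $$ (s, e) = A $$ (s, d)))"
    by (rule sum.swap)
  also have "\<dots> = (\<Sum>r<m. \<Sum>s<m. \<Sum>e<n ^ 2. of_bool (A $$ (r, c) = A $$ (r, e)) * of_bool (A $$ (s, e) = A $$ (s, d)))"
    by (intro sum.cong refl sum.swap)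
  also have "\<dots> = (\<Sum>r<m. \<Sum>s<m. 1 + (if s = r then real n * of_bool (A $$ (r, c) = A $$ (r, d)) - 1 else 0))"
    using rows by (intro sum.cong refl) auto
  also have "\<dots> = (\<Sum>r<m. real m + (real n * of_bool (A $$ (r, c) = A $$ (r, d)) - 1))"
    by (intro sum.cong refl) (simp add: sum.distrib)
  also have "\<dots> = real n * agreements c d + real m * (real m - 1)"
    by (simp add: sum.distrib sum_subtractf agreements_def sum_distrib_left algebra_simps)
  finally show ?thesis .
qed

lemma sum_adj:
  assumes c: "c < n ^ 2"
  shows "(\<Sum>e<n ^ 2. adj c e) = real m * (real n - 1)"
  using sum_agreements[OF c] sum_delta(1)[OF c, of "\<lambda>_. 1"]
  by (simp add: adj_def sum_subtractf sum_distrib_left[symmetric] algebra_simps)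

lemma sum_adj_side:
  assumes c: "c < n ^ 2"
  shows "(\<Sum>e<n ^ 2. adj c e * side e) = (real n - real m) * side c + (real m - 1) * excess"
proof -
  have "(\<Sum>e<n ^ 2. adj c e * side e)
      = (\<Sum>e<n ^ 2. agreements c e * side e - real m * (of_bool (c = e) * side e))"
    by (simp add: adj_def algebra_simps)
  then show ?thesis
    using sum_agreements_side[OF c] sum_delta(1)[OF c, of side]
    by (simp add: sum_subtractf sum_distrib_left[symmetric] algebra_simps)
qed

lemma sum_adj_adj:
  assumes c: "c < n ^ 2" and d: "d < n ^ 2"
  shows "(\<Sum>e<n ^ 2. adj c e * adj e d) = (real n - 2 * real m) * adj c d
    + real m * (real m - 1) + real m * (real n - real m) * of_bool (c = d)"
proof -
  have "(\<Sum>e<n ^ 2. adj c e * adj e d) = (\<Sum>e<n ^ 2. agreements c e * agreements e d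
      - real m * (agreements c e * of_bool (e = d)) - real m * (of_bool (c = e) * agreements e d)
      + real m ^ 2 * (of_bool (c = e) * of_bool (e = d)))"
    by (intro sum.cong refl) (simp add: adj_def algebra_simps power2_eq_square)
  also have "\<dots> = (real n * agreements c d + real m * (real m - 1)) - real m * agreements c d
      - real m * agreements c d + real m ^ 2 * of_bool (c = d)"
    using sum_agreements_agreements[OF c d] sum_delta(2)[OF d, of "agreements c"]
      sum_delta(1)[OF c, of "\<lambda>e. agreements e d"] sum_delta(1)[OF c, of "\<lambda>e. of_bool (e = d)"]
    by (simp add: sum.distrib sum_subtractf sum_distrib_left[symmetric])
  also have "agreements c d = adj c d + real m * of_bool (c = d)" by (simp add: adj_def)
  finally show ?thesis by (simp add: algebra_simps power2_eq_square)
qed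

text \<open>
  The adjacency matrix of the switched graph (see \<open>switched_eq\<close>): switching conjugates
  \<open>adj - J/2\<close> by the diagonal matrix of signs.
\<close>

definition switched :: "nat \<Rightarrow> nat \<Rightarrow> real" where
  "switched c d = 1 / 2 + side c * side d * (adj c d - 1 / 2)"

lemma sum_switched:
  assumes c: "c < n ^ 2"
  shows "(\<Sum>d<n ^ 2. switched c d) = real n ^ 2 / 2
    + side c * (((real n - real m) * side c + (real m - 1) * excess) - real n * excess / 2)"
proof -
  have "(\<Sum>d<n ^ 2. switched c d)
      = (\<Sum>d<n ^ 2. 1 / 2 + side c * (adj c d * side d - side d / 2))"
    by (intro sum.cong refl) (simp add: switched_def algebra_simps)
  also have "\<dots> = real n ^ 2 / 2 + side c * ((\<Sum>d<n ^ 2. adj c d * side d) - (\<Sum>d<n ^ 2. side d) / 2)"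
    by (simp add: sum.distrib sum_subtractf sum_distrib_left[symmetric] sum_divide_distrib[symmetric])
  finally show ?thesis using sum_adj_side[OF c] sum_side by simp
qed

lemma sum_switched_side:
  assumes c: "c < n ^ 2"
  shows "(\<Sum>d<n ^ 2. switched c d * side d)
    = real n * excess / 2 + side c * (real m * (real n - 1) - real n ^ 2 / 2)"
proof -
  have "(\<Sum>d<n ^ 2. switched c d * side d)
      = (\<Sum>d<n ^ 2. side d / 2 + side c * (adj c d - 1 / 2))"
  proof (intro sum.cong refl)
    fix d
    have "switched c d * side d = side d / 2 + side c * (adj c d - 1 / 2) * (side d * side d)"
      by (simp add: switched_def algebra_simps)
    then show "switched c d * side d = side d / 2 + side c * (adj c d - 1 / 2)"
      by (simp add: side_square)
  qed
  also have "\<dots> = (\<Sum>d<n ^ 2. side d) / 2 + side c * ((\<Sum>d<n ^ 2. adj c d) - real n ^ 2 / 2)"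
    by (simp add: sum.distrib sum_subtractf sum_distrib_left[symmetric] sum_divide_distrib[symmetric])
  finally show ?thesis using sum_adj[OF c] sum_side by simp
qed

lemma sum_switched_switched:
  assumes c: "c < n ^ 2" and d: "d < n ^ 2"
  shows "(\<Sum>e<n ^ 2. switched c e * switched e d) = real n ^ 2 / 4
    + side d / 2 * (((real n - real m) * side d + (real m - 1) * excess) - real n * excess / 2)
    + side c / 2 * (((real n - real m) * side c + (real m - 1) * excess) - real n * excess / 2)
    + side c * side d * ((real n - 2 * real m) * adj c d + real m * (real m - 1)
      + real m * (real n - real m) * of_bool (c = d) - real m * (real n - 1) + real n ^ 2 / 4)"
proof -
  have "(\<Sum>e<n ^ 2. switched c e * switched e d) = (\<Sum>e<n ^ 2. 1 / 4
      + side d / 2 * (adj d e * side e - side e / 2) + side c / 2 * (adj c e * side e - side e / 2)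
      + side c * side d * (adj c e * adj e d - adj c e / 2 - adj d e / 2 + 1 / 4))"
  proof (intro sum.cong refl)
    fix e
    have "switched c e * switched e d = 1 / 4
        + side d / 2 * (adj e d * side e - side e / 2) + side c / 2 * (adj c e * side e - side e / 2)
        + side c * side d * (adj c e * adj e d - adj c e / 2 - adj e d / 2 + 1 / 4) * (side e * side e)"
      unfolding switched_def by (simp add: field_simps)
    then show "switched c e * switched e d = 1 / 4
        + side d / 2 * (adj d e * side e - side e / 2) + side c / 2 * (adj c e * side e - side e / 2)
        + side c * side d * (adj c e * adj e d - adj c e / 2 - adj d e / 2 + 1 / 4)"
      by (simp add: side_square adj_sym[of e d])
  qed
  also have "\<dots> = real n ^ 2 / 4
      + side d / 2 * ((\<Sum>e<n ^ 2. adj d e * side e) - (\<Sum>e<n ^ 2. side e) / 2)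
      + side c / 2 * ((\<Sum>e<n ^ 2. adj c e * side e) - (\<Sum>e<n ^ 2. side e) / 2)
      + side c * side d * ((\<Sum>e<n ^ 2. adj c e * adj e d) - (\<Sum>e<n ^ 2. adj c e) / 2
        - (\<Sum>e<n ^ 2. adj d e) / 2 + real n ^ 2 / 4)"
    by (simp only: sum.distrib sum_subtractf sum_distrib_left[symmetric] sum_divide_distrib[symmetric])
       simp
  finally show ?thesis
    unfolding sum_adj[OF c] sum_adj[OF d] sum_adj_side[OF c] sum_adj_side[OF d] sum_side
      sum_adj_adj[OF c d] by (simp add: algebra_simps)
qed

lemma side_iff:
  assumes "c < n ^ 2"
  shows "c \<in> (\<Union>i\<in>{1..N}. row_clique A i) \<longleftrightarrow> side c = 1"
  using entry[of 0 c] m_ge_2 assms carrier by (auto simp: row_clique_def side_def)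

lemma block_graph_verts: "pverts (block_graph A) = {..<n ^ 2}"
  using carrier by (simp add: block_graph_def)

lemma verts: "pverts (S_graph N A) = {..<n ^ 2}"
  by (simp add: S_graph_def switching_def block_graph_verts)

lemma arcs_subset: "parcs (S_graph N A) \<subseteq> {..<n ^ 2} \<times> {..<n ^ 2}"
  unfolding S_graph_def switching_def block_graph_verts by auto

lemma switched_eq:
  assumes c: "c < n ^ 2" and d: "d < n ^ 2"
  shows "switched c d = of_bool ((c, d) \<in> parcs (S_graph N A))"
proof -
  have arc: "(c, d) \<in> parcs (block_graph A) \<longleftrightarrow> adj c d = 1"
    using c d carrier by (simp add: adj_eq block_graph_def)
  have side: "side e = 1 \<or> side e = - 1" for e by (simp add: side_def)
  have "(c, d) \<in> parcs (S_graph N A) \<longleftrightarrow>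
      (if side c = 1 \<longleftrightarrow> side d = 1 then adj c d = 1 else adj c d \<noteq> 1)"
    unfolding S_graph_def switching_def block_graph_verts pair_pre_digraph.simps mem_Collect_eq
      case_prod_conv lessThan_iff side_iff[OF c] side_iff[OF d] arc by (simp only: c d simp_thms)
  moreover have "adj c d = 0 \<or> adj c d = 1"
  proof -
    have "of_bool P = (0 :: real) \<or> of_bool P = (1 :: real)" for P by (cases P) simp_all
    then show ?thesis unfolding adj_eq[OF c d] .
  qed
  ultimately show ?thesis using side[of c] side[of d]
    by (elim disjE) (simp_all add: switched_def)
qed

lemma adjacency_matrix_eq:
  "adjacency_matrix (S_graph N A) = mat (n ^ 2) (n ^ 2) (\<lambda>(c, d). switched c d)"
proof -
  have "sorted_list_of_set {..<n ^ 2} = [0..<n ^ 2]"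
    using sorted_list_of_set_range[of 0 "n ^ 2"] by (simp add: atLeast0LessThan)
  then show ?thesis
    unfolding adjacency_matrix_def Let_def verts
    by (intro eq_matI) (auto simp: switched_eq)
qed

lemma out_degree_eq:
  assumes c: "c < n ^ 2"
  shows "real (out_degree (with_proj (S_graph N A)) c) = (\<Sum>d<n ^ 2. switched c d)"
proof -
  have "out_arcs (with_proj (S_graph N A)) c = Pair c ` {d \<in> {..<n ^ 2}. (c, d) \<in> parcs (S_graph N A)}"
    using arcs_subset by (auto simp: out_arcs_def)
  then have "out_degree (with_proj (S_graph N A)) c = card {d \<in> {..<n ^ 2}. (c, d) \<in> parcs (S_graph N A)}"
    by (simp add: out_degree_def card_image inj_on_def)
  also have "real \<dots> = (\<Sum>d<n ^ 2. of_bool ((c, d) \<in> parcs (S_graph N A)))"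
    by (simp add: Int_def)
  also have "\<dots> = (\<Sum>d<n ^ 2. switched c d)"
    using c by (intro sum.cong) (auto simp: switched_eq)
  finally show ?thesis .
qed

text \<open>
  The degree of a vertex depends only on its side, and differs between the sides by \<open>3 excess\<close>.
\<close>

lemma biregular_switched:
  assumes n: "n = 2 * m + 1" and N0: "0 < N" "N < n" and ex: "excess \<noteq> 0"
  shows "biregular (S_graph N A)"
proof -
  let ?deg = "out_degree (with_proj (S_graph N A))"
  have deg: "real (?deg c) = (real n ^ 2 + real n + 1) / 2 - 3 / 2 * excess * side c" if c: "c < n ^ 2" for c
  proof -
    have "side c * (((real n - real m) * side c + (real m - 1) * excess) - real n * excess / 2)
        = (real n - real m) * (side c * side c) + side c * excess * (real m - 1 - real n / 2)"
      by (simp add: algebra_simps)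
    then show ?thesis
      using out_degree_eq[OF c] sum_switched[OF c] by (simp add: side_square n field_simps)
  qed
  have symbol: "\<exists>c<n ^ 2. A $$ (0, c) = x" if "x \<in> {1..n}" for x
  proof -
    have "0 < m" "1 < m" using m_ge_2 by auto
    then have "(x, x) \<in> (\<lambda>c. (A $$ (0, c), A $$ (1, c))) ` {..<n ^ 2}"
      using bij_betw_imp_surj_on[OF orthogonal_array_pair_bij[OF A, of 0 1]] that by simp
    then show ?thesis by auto
  qed
  obtain c d
    where c: "c < n ^ 2" "side c = 1" and d: "d < n ^ 2" "side d = - 1"
  proof -
    obtain c where "c < n ^ 2" "A $$ (0, c) = 1" using symbol[of 1] n_ge_1 by auto
    moreover obtain d where "d < n ^ 2" "A $$ (0, d) = n" using symbol[of n] n_ge_1 by auto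
    ultimately show thesis using N0 by (intro that[of c d]) (auto simp: side_def)
  qed
  have "?deg c \<noteq> ?deg d" using deg[OF c(1)] deg[OF d(1)] c(2) d(2) ex by auto
  moreover have "?deg e = ?deg c \<or> ?deg e = ?deg d" if e: "e < n ^ 2" for e
  proof (cases "side e = 1")
    case True
    then have "real (?deg e) = real (?deg c)" using deg[OF e] deg[OF c(1)] c(2) by simp
    then show ?thesis by simp
  next
    case False
    then have "side e = - 1" by (simp add: side_def split: if_splits)
    then have "real (?deg e) = real (?deg d)" using deg[OF e] deg[OF d(1)] d(2) by simp
    then show ?thesis by simp
  qed
  then have "?deg ` pverts (S_graph N A) = {?deg c, ?deg d}"
    unfolding verts using c(1) d(1) by auto
  ultimately show ?thesis by (simp add: biregular_def)
qed

lemma spectrum_switched: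
  assumes n: "n = 2 * m + 1" and ex: "3 * excess ^ 2 = real n * (real n + 2)"
  shows "graph_spectrum (S_graph N A) = {#(real n ^ 2 + 1) / 2#}
    + replicate_mset ((n ^ 2 - 2 * n - 1) div 2) ((real n + 1) / 2)
    + replicate_mset ((n ^ 2 + 2 * n - 1) div 2) ((1 - real n) / 2)"
proof -
  define w where "w c = side c - excess" for c
  let ?B = "mat (n ^ 2) (n ^ 2) (\<lambda>(c, d). switched c d)"
  have m: "real m = (real n - 1) / 2" using n by simp
  have ex': "excess * excess = real n * (real n + 2) / 3" using ex by (simp add: power2_eq_square)
  have m_pos: "1 \<le> m" using m_ge_2 by simp
  have k: "(n ^ 2 - 2 * n - 1) div 2 = 2 * m ^ 2 - 1" and l: "(n ^ 2 + 2 * n - 1) div 2 = 2 * m ^ 2 + 4 * m + 1"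
    by (simp_all add: n power2_eq_square algebra_simps)
  have mm: "1 \<le> m ^ 2" using m_pos by simp
  show ?thesis
    unfolding graph_spectrum_def adjacency_matrix_eq
  proof (rule proots_char_poly_rank_one_quadratic[where c = "3 / 4" and w = w and n = "n ^ 2"])
    fix c d assume cd: "c < n ^ 2" "d < n ^ 2"
    have "(\<Sum>e<n ^ 2. switched c e * switched e d)
      = ((real n + 1) / 2 + (1 - real n) / 2) * switched c d - (real n + 1) / 2 * ((1 - real n) / 2) * of_bool (c = d)
        + 3 / 4 * w c * w d"
      unfolding sum_switched_switched[OF cd] unfolding switched_def w_def
      by (rule rank_one_identity) (use side_square ex' m in auto)
    then show "(\<Sum>e<n ^ 2. ?B $$ (c, e) * ?B $$ (e, d))
      = ((real n + 1) / 2 + (1 - real n) / 2) * ?B $$ (c, d) - (real n + 1) / 2 * ((1 - real n) / 2) * of_bool (c = d)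
        + 3 / 4 * w c * w d"
      using cd by simp
  next
    fix c assume c: "c < n ^ 2"
    have "(\<Sum>d<n ^ 2. ?B $$ (c, d) * w d) = (\<Sum>d<n ^ 2. switched c d * side d) - excess * (\<Sum>d<n ^ 2. switched c d)"
      using c by (simp add: w_def right_diff_distrib sum_subtractf sum_distrib_left mult_ac)
    also have "\<dots> = (real n ^ 2 + 1) / 2 * w c"
      unfolding sum_switched_side[OF c] sum_switched[OF c] w_def
      by (rule eigenvector_identity) (use side_square ex' m in auto)
    finally show "(\<Sum>d<n ^ 2. ?B $$ (c, d) * w d) = (real n ^ 2 + 1) / 2 * w c" .
  next
    have "(\<Sum>c<n ^ 2. w c * w c) = (\<Sum>c<n ^ 2. (1 + excess * excess) - 2 * excess * side c)"
      using side_square by (intro sum.cong) (auto simp: w_def algebra_simps)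
    also have "\<dots> = real n ^ 2 * (1 + excess * excess) - 2 * excess * (real n * excess)"
      by (simp add: sum_subtractf sum_distrib_left[symmetric] sum_side)
    also have "\<dots> = real n ^ 2 * (1 + excess * excess) - 2 * real n * (excess * excess)" by simp
    finally show "3 / 4 * (\<Sum>c<n ^ 2. w c * w c)
        = ((real n ^ 2 + 1) / 2 - (real n + 1) / 2) * ((real n ^ 2 + 1) / 2 - (1 - real n) / 2)"
      unfolding ex' by (simp add: field_simps power2_eq_square)
  next
    have "(\<Sum>c<n ^ 2. ?B $$ (c, c)) = (\<Sum>c<n ^ 2. switched c c)" by simp
    also have "\<dots> = (\<Sum>c<n ^ 2. 0)"
      by (intro sum.cong) (auto simp: switched_def adj_eq side_square)
    finally show "(\<Sum>c<n ^ 2. ?B $$ (c, c)) = (real n ^ 2 + 1) / 2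
        + real ((n ^ 2 - 2 * n - 1) div 2) * ((real n + 1) / 2)
        + real ((n ^ 2 + 2 * n - 1) div 2) * ((1 - real n) / 2)"
      unfolding k l using mm by (simp add: n of_nat_diff field_simps power2_eq_square)
  next
    show "n ^ 2 = Suc ((n ^ 2 - 2 * n - 1) div 2 + (n ^ 2 + 2 * n - 1) div 2)"
      unfolding k l using mm by (simp add: n power2_eq_square algebra_simps)
  next
    have "1 < real n" using m_pos n by simp
    then show "(real n ^ 2 + 1) / 2 \<noteq> (real n + 1) / 2" "(real n ^ 2 + 1) / 2 \<noteq> (1 - real n) / 2"
      "(real n + 1) / 2 \<noteq> (1 - real n) / 2"
      by (rule three_values_distinct)+
  qed simp
qed

end

section \<open>The number of switched cliques\<close>

text \<open>
  Consecutive terms satisfy \<open>u\<^sup>2 - 4 u v + v\<^sup>2 = 6\<close>, that is \<open>(u - 2 v)\<^sup>2 = 3 (v\<^sup>2 + 2)\<close>. Since \<open>3\<close>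
  divides \<open>u - 2 v\<close>, the number \<open>(v\<^sup>2 + 2)/3\<close> is a perfect square.
\<close>

lemma recurrence_odd_and_norm_equation:
  fixes a :: "nat \<Rightarrow> int"
  assumes a0: "a 0 = 1" and a1: "a 1 = 5"
    and rec: "\<And>j. j \<ge> 2 \<Longrightarrow> a j = 4 * a (j - 1) - a (j - 2)"
  shows "odd (a k) \<and> (\<exists>b. 0 < b \<and> (a k)\<^sup>2 + 2 = 3 * b\<^sup>2)"
proof -
  have rec': "a (Suc (Suc j)) = 4 * a (Suc j) - a j" for j using rec[of "Suc (Suc j)"] by simp
  have "0 < a j \<and> a j < a (Suc j) \<and> odd (a j) \<and> odd (a (Suc j))
     \<and> (a (Suc j))\<^sup>2 - 4 * a (Suc j) * a j + (a j)\<^sup>2 = 6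
     \<and> 3 dvd a (Suc j) - 2 * a j" for j
  proof (induction j)
    case 0
    then show ?case using a0 a1 by simp
  next
    case (Suc j)
    then have IH: "0 < a j" "a j < a (Suc j)" "odd (a j)" "odd (a (Suc j))"
      "(a (Suc j))\<^sup>2 - 4 * a (Suc j) * a j + (a j)\<^sup>2 = 6" "3 dvd a (Suc j) - 2 * a j" by auto
    have "(a (Suc (Suc j)))\<^sup>2 - 4 * a (Suc (Suc j)) * a (Suc j) + (a (Suc j))\<^sup>2 = 6"
      unfolding rec' using IH(5) by (simp add: power2_eq_square algebra_simps)
    moreover have "3 dvd a (Suc (Suc j)) - 2 * a (Suc j)"
    proof -
      have "a (Suc (Suc j)) - 2 * a (Suc j) = 2 * (a (Suc j) - 2 * a j) + 3 * a j"
        unfolding rec' by simp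
      then show ?thesis using dvd_add[OF dvd_mult[OF IH(6)] dvd_triv_left] by metis
    qed
    moreover have "0 < a (Suc j)" "a (Suc j) < a (Suc (Suc j))" "odd (a (Suc (Suc j)))"
      using IH(1-4) rec'[of j] by auto
    ultimately show ?case using IH(4) by blast
  qed
  note inv = this[of k]
  obtain b where b: "a (Suc k) - 2 * a k = 3 * b"
    using inv unfolding dvd_def by blast
  have "(a (Suc k) - 2 * a k)\<^sup>2 = 3 * (a k)\<^sup>2 + 6"
    using inv by (simp add: power2_eq_square algebra_simps)
  then have "(a k)\<^sup>2 + 2 = 3 * b\<^sup>2" unfolding b by (simp add: power2_eq_square)
  then have "(a k)\<^sup>2 + 2 = 3 * \<bar>b\<bar>\<^sup>2" by simp
  moreover have "0 < \<bar>b\<bar>"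
  proof -
    have "0 < (a k)\<^sup>2 + 2" by (rule add_nonneg_pos) simp_all
    then show ?thesis using \<open>(a k)\<^sup>2 + 2 = 3 * b\<^sup>2\<close> by (cases "b = 0") auto
  qed
  moreover have "odd (a k)" using inv by auto
  ultimately show ?thesis by blast
qed

text \<open>
  For \<open>n = 2 m + 1\<close>, the formula for \<open>N\<close> says that \<open>2 N - n\<close> is the negative root of
  \<open>3 E\<^sup>2 = n (n + 2)\<close>.
\<close>

lemma G_graphs_excess:
  assumes m: "n = 2 * m + 1"
    and N: "real N = real n / 2 - sqrt ((real n - 2 * real m) * (real n - 2 * real m + 2) * (real n + 2) * real n)
      / (2 * (real n - 2 * real m + 2))"
  shows "3 * (2 * real N - real n) ^ 2 = real n * (real n + 2)"
proof -
  have "real n - 2 * real m = 1" using m by simp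
  then have "2 * real N - real n = - sqrt (3 * (real n + 2) * real n) / 3"
    using N by simp
  then show ?thesis by (simp add: power_divide)
qed

theorem corollary7p7:
  fixes a :: "nat \<Rightarrow> int" and k q :: nat
  assumes "a 0 = 1" and "a 1 = 5"
    and "\<And>j. j \<ge> 2 \<Longrightarrow> a j = 4 * a (j - 1) - a (j - 2)"
    and "int q = a k"
    and "primepow q"
  shows "G_graphs ((q ^ 2 - 1) div 2) (q ^ 2) \<noteq> {} \<and>
    (\<forall>G \<in> G_graphs ((q ^ 2 - 1) div 2) (q ^ 2).
       biregular G \<and>
       graph_spectrum G =
         replicate_mset 1 ((real q ^ 4 + 1) / 2)
         + replicate_mset ((q ^ 4 - 2 * q ^ 2 - 1) div 2) ((real q ^ 2 + 1) / 2)
         + replicate_mset ((q ^ 4 + 2 * q ^ 2 - 1) div 2) ((1 - real q ^ 2) / 2))"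
proof -
  define m n where "m = (q ^ 2 - 1) div 2" and "n = q ^ 2"
  obtain b' :: int where "odd (int q)" and b': "0 < b'" "(int q)\<^sup>2 + 2 = 3 * b'\<^sup>2"
    using recurrence_odd_and_norm_equation[OF assms(1-3), of k] unfolding assms(4) by blast
  then have q: "odd q" by simp
  define b where "b = nat b'"
  have "int (q ^ 2 + 2) = int (3 * b ^ 2)" using b' by (simp add: b_def)
  then have b: "q ^ 2 + 2 = 3 * b ^ 2" unfolding of_nat_eq_iff .
  have q1: "1 < q" using primepow_gt_Suc_0[OF assms(5)] by simp
  have "q \<noteq> 2" using q by auto
  then have q3: "3 \<le> q" using q1 by simp
  have "odd n" using q by (simp add: n_def)
  then have n: "n = 2 * m + 1" by (auto simp: m_def n_def elim!: oddE)
  have n9: "3 ^ 2 \<le> n" unfolding n_def by (rule power_mono) (use q3 in auto)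
  then have m2: "2 \<le> m" using n by simp
  have "biregular G \<and> graph_spectrum G = replicate_mset 1 ((real q ^ 4 + 1) / 2)
      + replicate_mset ((q ^ 4 - 2 * q ^ 2 - 1) div 2) ((real q ^ 2 + 1) / 2)
      + replicate_mset ((q ^ 4 + 2 * q ^ 2 - 1) div 2) ((1 - real q ^ 2) / 2)"
    if G_in: "G \<in> G_graphs m n" for G
  proof -
    obtain N A where G: "G = S_graph N A" and A: "orthogonal_array m n A" and N_bounds: "0 < N" "N < n"
      and ex: "3 * (2 * real N - real n) ^ 2 = real n * (real n + 2)"
      using G_in G_graphs_excess[OF n] unfolding G_graphs_def Let_def by blast
    interpret block_switching m n N A using A N_bounds by unfold_locales auto
    have ex': "3 * excess ^ 2 = real n * (real n + 2)" using ex by (simp add: excess_def)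
    then have "excess \<noteq> 0" using n_ge_1 by auto
    moreover have "n ^ 2 = q ^ 4" "real n ^ 2 = real q ^ 4" "real n = real q ^ 2"
      by (simp_all add: n_def flip: power_mult)
    ultimately show ?thesis
      using biregular_switched[OF n N_bounds _] spectrum_switched[OF n ex'] unfolding G by (simp add: n_def)
  qed
  moreover have "G_graphs m n \<noteq> {}"
  proof -
    obtain p e where "prime p" "e > 0" "q = p ^ e" using assms(5) by (auto simp: primepow_def)
    then have "primepow n"
      unfolding primepow_def n_def by (intro exI[of _ p] exI[of _ "e * 2"]) (simp add: power_mult)
    then obtain A where A: "orthogonal_array m n A"
      using orthogonal_array_exists[of n m] m2 n by auto
    have "odd b"
    proof
      assume "even b"
      then have "even (q ^ 2 + 2)" unfolding b by simp
      then show False using q by simp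
    qed
    have "b < q"
    proof (rule ccontr)
      assume "\<not> b < q"
      then have "q ^ 2 \<le> b ^ 2" by (intro power_mono) auto
      moreover have "1 < q ^ 2" using n9 by (simp add: n_def)
      ultimately show False using b by linarith
    qed
    \<comment> \<open>The excess \<open>2 N - n\<close> of the array of order \<open>n = q\<^sup>2\<close> must be \<open>- q b\<close>.\<close>
    define N where "N = q * ((q - b) div 2)"
    have "2 dvd q - b" using q \<open>odd b\<close> \<open>b < q\<close> by simp
    then have half: "real ((q - b) div 2) = (real q - real b) / 2"
      using \<open>b < q\<close> by (simp add: real_of_nat_div of_nat_diff)
    have N_eq: "real N = (real n - real q * real b) / 2"
      by (simp add: N_def half n_def power2_eq_square algebra_simps)
    have "0 < b" using \<open>odd b\<close> by (rule odd_pos)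
    have "0 < real q * (real q - real b)" using q1 \<open>b < q\<close> by simp
    then have "0 < real N" by (simp add: N_eq n_def power2_eq_square algebra_simps)
    moreover have "real N < real n"
    proof -
      have "0 \<le> real q * real b" by simp
      moreover have "0 < real n" using n9 by simp
      ultimately show ?thesis unfolding N_eq by argo
    qed
    moreover have nm: "real n - 2 * real m = 1" using n by simp
    have nb: "real n + 2 = 3 * real b ^ 2" using arg_cong[OF b, of real] by (simp add: n_def)
    have radicand: "(real n - 2 * real m) * (real n - 2 * real m + 2) * (real n + 2) * real n
        = (3 * real b * real q) ^ 2"
      unfolding nm nb by (simp add: n_def power2_eq_square)
    moreover have "sqrt ((3 * real b * real q) ^ 2) = 3 * real b * real q" by simp
    moreover have "real N = real n / 2 - 3 * real b * real q / (2 * (real n - 2 * real m + 2))"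
      unfolding nm N_eq by (simp add: field_simps)
    ultimately have "S_graph N A \<in> G_graphs m n"
      using A nm unfolding G_graphs_def Let_def radicand
      by (intro CollectI exI[of _ N] exI[of _ A]) simp
    then show ?thesis by blast
  qed
  ultimately show ?thesis unfolding m_def n_def by blast
qed

end
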